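(* Let $p>1$ and let $k\geq r\geq 3$ be integers. For every $\varepsilon>0$ there are $\delta=\delta(k,r,\varepsilon)>0$ and $n_0=n_0(k,r,\varepsilon)$ such that for all $n>n_0$: if $H$ is an $n$-vertex $F_{k+1}^{(r)}$-free $r$-graph with \[ \lambda^{(p)}(H)>(1-\delta)\frac{(k)_r}{k^r}n^{r(1-1/p)}, \] then $H$ can be transformed to $T_r(n,k)$ by adding and deleting at most $\varepsilon\binom{n}{r}$ edges.
   Context: An $r$-graph is an $r$-uniform hypergraph. For an $r$-graph $H$ on vertex set $[n]$ and real $p\geq1$, $\lambda^{(p)}(H)=\max_{\bm{x}\in\mathbb{R}^n,\ \|\bm{x}\|_p=1} r!\sum_{e\in E(H)}\prod_{v\in e}x_v$. $(k)_r=k(k-1)\cdots(k-r+1)$. $T_r(n,k)$ is the complete $k$-partite $r$-graph on $n$ vertices with part sizes differing by at most one (edges: all $r$-sets with at most one vertex in each part). $F_{k+1}^{(r)}$ is the $r$-graph with edges $[r]$ and $E_{ij}\cup\{i,j\}$ for all pairs $\{i,j\}\in\binom{[k+1]}{2}\setminus\binom{[r]}{2}$, where the $E_{ij}$ are pairwise disjoint $(r-2)$-sets disjoint from $[k+1]$. $H$ is $F$-free if it has no subgraph isomorphic to $F$.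
   Formalization: Here δ and n₀ may depend on p as well as on k, r, ε; independence of p is impossible, since T_r(n/2,k) with n/2 isolated vertices satisfies the bound for any fixed δ once p is close to 1 but is far from T_r(n,k). *)

theory Defs
  imports "HOL-Analysis.Analysis"
begin

section \<open>Hypergraphs\<close>

record 'a hypergraph =
  verts :: "'a set"
  edges :: "'a set set"

definition r_graph :: "nat \<Rightarrow> 'a hypergraph \<Rightarrow> bool" where
  "r_graph r H \<longleftrightarrow> finite (verts H) \<and> (\<forall>e\<in>edges H. e \<subseteq> verts H \<and> card e = r)"

definition subgraph :: "'a hypergraph \<Rightarrow> 'a hypergraph \<Rightarrow> bool" where
  "subgraph G H \<longleftrightarrow> verts G \<subseteq> verts H \<and> edges G \<subseteq> edges H \<and> (\<forall>e\<in>edges G. e \<subseteq> verts G)"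

definition isomorphic :: "'a hypergraph \<Rightarrow> 'b hypergraph \<Rightarrow> bool" where
  "isomorphic G H \<longleftrightarrow>
     (\<exists>f. bij_betw f (verts G) (verts H) \<and> edges H = (\<lambda>e. f ` e) ` edges G)"

definition is_free :: "'b hypergraph \<Rightarrow> 'a hypergraph \<Rightarrow> bool" where
  "is_free F H \<longleftrightarrow> \<not> (\<exists>G. subgraph G H \<and> isomorphic F G)"


section \<open>The $r$-graph $F_m^{(r)}$\<close>

text \<open>
  \<open>Core i\<close> is the vertex $i \in [m]$; the vertices \<open>Expansion i j t\<close> with $1 \le t \le r - 2$
  form the set $E_{ij}$, where the pair $\{i,j\}$ is represented by $i < j$. For $i < j$ the
  condition $\{i,j\} \not\subseteq [r]$ amounts to $r < j$.
\<close>

datatype F_vertex = Core nat | Expansion nat nat nat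

definition F_pairs :: "nat \<Rightarrow> nat \<Rightarrow> (nat \<times> nat) set" where
  "F_pairs r m = {(i, j). 1 \<le> i \<and> i < j \<and> j \<le> m \<and> r < j}"

definition F_expansion :: "nat \<Rightarrow> nat \<Rightarrow> nat \<Rightarrow> F_vertex set" where
  "F_expansion r i j = Expansion i j ` {1..r - 2}"

definition F_graph :: "nat \<Rightarrow> nat \<Rightarrow> F_vertex hypergraph" where
  "F_graph r m =
     \<lparr> verts = Core ` {1..m} \<union> (\<Union>(i, j)\<in>F_pairs r m. F_expansion r i j),
       edges = insert (Core ` {1..r})
                 ((\<lambda>(i, j). F_expansion r i j \<union> {Core i, Core j}) ` F_pairs r m) \<rparr>"


section \<open>The balanced complete $k$-partite $r$-graph $T_r(n,k)$\<close>

text \<open>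
  \<open>is_turan r n k T\<close> says that \<open>T\<close> is a copy of $T_r(n,k)$, which is determined only up to
  isomorphism. Parts may be empty (when $n < k$).
\<close>

definition is_turan :: "nat \<Rightarrow> nat \<Rightarrow> nat \<Rightarrow> 'a hypergraph \<Rightarrow> bool" where
  "is_turan r n k T \<longleftrightarrow>
     finite (verts T) \<and> card (verts T) = n \<and>
     (\<exists>P :: nat \<Rightarrow> 'a set.
        verts T = (\<Union>i<k. P i) \<and>
        disjoint_family_on P {..<k} \<and>
        (\<forall>i<k. \<forall>j<k. card (P i) \<le> card (P j) + 1) \<and>
        edges T = {e. e \<subseteq> verts T \<and> card e = r \<and> (\<forall>i<k. card (e \<inter> P i) \<le> 1)})"


section \<open>Edge edits\<close>

text \<open>
  The edges added and deleted in passing from \<open>H\<close> to a copy \<open>T\<close> of $T_r(n,k)$ on the same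
  vertex set are those of \<open>edges T - edges H\<close> and of \<open>edges H - edges T\<close>; they are counted
  together.
\<close>

definition transformable_to_turan :: "nat \<Rightarrow> nat \<Rightarrow> nat \<Rightarrow> 'a hypergraph \<Rightarrow> real \<Rightarrow> bool" where
  "transformable_to_turan r n k H b \<longleftrightarrow>
     (\<exists>T. is_turan r n k T \<and> verts T = verts H \<and>
          real (card (edges T - edges H) + card (edges H - edges T)) \<le> b)"


section \<open>The $p$-spectral radius\<close>

definition p_norm :: "real \<Rightarrow> 'a set \<Rightarrow> ('a \<Rightarrow> real) \<Rightarrow> real" where
  "p_norm p V x = (\<Sum>v\<in>V. \<bar>x v\<bar> powr p) powr (1 / p)"

definition lagrange_poly :: "nat \<Rightarrow> 'a hypergraph \<Rightarrow> ('a \<Rightarrow> real) \<Rightarrow> real" where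
  "lagrange_poly r H x = fact r * (\<Sum>e\<in>edges H. \<Prod>v\<in>e. x v)"

text \<open>
  Vectors are total functions of which only the values on \<open>verts H\<close> matter. The supremum is a
  maximum, see \<open>p_spectral_radius_attained\<close> below.
\<close>

definition p_spectral_radius :: "nat \<Rightarrow> real \<Rightarrow> 'a hypergraph \<Rightarrow> real" where
  "p_spectral_radius r p H = (SUP x\<in>{x. p_norm p (verts H) x = 1}. lagrange_poly r H x)"

definition falling_factorial :: "nat \<Rightarrow> nat \<Rightarrow> real" where
  "falling_factorial k r = (\<Prod>i<r. real k - real i)"

lemma p_norm_eq_1_iff:
  assumes "p > 0"
  shows "p_norm p V x = 1 \<longleftrightarrow> (\<Sum>v\<in>V. \<bar>x v\<bar> powr p) = 1"
proof
  assume a: "p_norm p V x = 1"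
  have "(\<Sum>v\<in>V. \<bar>x v\<bar> powr p) = ((\<Sum>v\<in>V. \<bar>x v\<bar> powr p) powr (1 / p)) powr p"
    using assms by (simp add: powr_powr sum_nonneg)
  then show "(\<Sum>v\<in>V. \<bar>x v\<bar> powr p) = 1"
    using a by (simp add: p_norm_def)
qed (simp add: p_norm_def)

lemma p_spectral_radius_attained:
  fixes H :: "'a hypergraph"
  assumes "r_graph r H" "verts H \<noteq> {}" "p \<ge> 1"
  shows "\<exists>x. p_norm p (verts H) x = 1 \<and> lagrange_poly r H x = p_spectral_radius r p H \<and>
             (\<forall>y. p_norm p (verts H) y = 1 \<longrightarrow> lagrange_poly r H y \<le> lagrange_poly r H x)"
proof -
  define V where "V = verts H"
  have fV: "finite V" and eV: "\<And>e. e \<in> edges H \<Longrightarrow> e \<subseteq> V"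
    using assms(1) by (auto simp: r_graph_def V_def)
  have p: "p > 0" using assms(3) by simp
  define S where "S = (\<lambda>x::'a \<Rightarrow> real. \<Sum>v\<in>V. \<bar>x v\<bar> powr p)"
  define L where "L = (\<lambda>x. lagrange_poly r H x)"
  define B where "B = PiE UNIV (\<lambda>v. if v \<in> V then {-1..1::real} else {0})"
  define C where "C = B \<inter> {x. S x = 1}"
  have "compactin (product_topology (\<lambda>_. euclidean) UNIV) B"
    unfolding B_def by (subst compactin_PiE) auto
  then have "compact B"
    by (simp add: euclidean_product_topology)
  moreover have contS: "continuous_on UNIV S"
    unfolding S_def using p
    by (intro continuous_intros continuous_on_powr' continuous_on_product_coordinates) auto
  have "closed {x. S x = 1}"
    by (intro closed_Collect_eq contS continuous_on_const)
  ultimately have compC: "compact C"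
    unfolding C_def by (rule compact_Int_closed)
  have contL: "continuous_on C L"
    unfolding L_def lagrange_poly_def
    by (intro continuous_intros continuous_on_subset[OF continuous_on_product_coordinates]) auto
  obtain v0 where v0: "v0 \<in> V" using assms(2) by (auto simp: V_def)
  have "S (\<lambda>v. if v = v0 then 1 else 0) = (\<Sum>v\<in>V. if v = v0 then 1 else 0)"
    unfolding S_def by (intro sum.cong) auto
  then have "(\<lambda>v. if v = v0 then 1 else 0) \<in> C"
    using v0 fV by (auto simp: C_def B_def)
  then obtain x where x: "x \<in> C" and max: "\<And>y. y \<in> C \<Longrightarrow> L y \<le> L x"
    using continuous_attains_sup[OF compC _ contL] by blast
  have all: "L y \<le> L x" if y: "S y = 1" for y
  proof -
    define z where "z = (\<lambda>v. if v \<in> V then y v else 0)"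
    have "S z = 1" using y unfolding S_def z_def by (simp cong: sum.cong)
    moreover have "\<bar>y v\<bar> \<le> 1" if "v \<in> V" for v
    proof -
      have "\<bar>y v\<bar> powr p \<le> S y"
        unfolding S_def by (rule member_le_sum[OF that]) (auto simp: fV)
      then show ?thesis
        using y p by (metis abs_ge_zero less_eq_real_def linorder_not_less one_le_numeral
            powr_less_mono2 powr_one_eq_one zero_le_one)
    qed
    ultimately have "z \<in> C" by (auto simp: C_def B_def z_def abs_le_iff)
    moreover have "L z = L y"
      unfolding L_def lagrange_poly_def z_def
      by (auto intro!: sum.cong prod.cong dest: subsetD[OF eV])
    ultimately show ?thesis using max by metis
  qed
  have iff: "p_norm p (verts H) y = 1 \<longleftrightarrow> S y = 1" for y
    using p_norm_eq_1_iff[OF p] by (simp add: S_def V_def)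
  have Sx: "S x = 1" using x by (simp add: C_def)
  have "p_spectral_radius r p H = L x"
    unfolding p_spectral_radius_def iff
  proof (rule cSup_eq_maximum)
    show "L x \<in> lagrange_poly r H ` {x. S x = 1}" using Sx by (auto simp: L_def)
  qed (use all in \<open>auto simp: L_def\<close>)
  then show ?thesis
    using iff Sx all by (auto simp: L_def)
qed

end

theory Submission
  imports Defs
begin

text \<open>
  Call a pair of vertices heavy if it lies in more than a large constant times $n^{r-3}$ edges of
  \<open>H\<close>. Deleting every edge that contains a light pair costs $O(n^{r-1})$ edges, and no clique of
  $k+1$ vertices in the graph \<open>E\<close> of heavy pairs contains a surviving edge, since a copy of
  $F_{k+1}^{(r)}$ could be completed greedily around it.

  For such a pair of \<open>E\<close> and \<open>H\<close>, let \<open>v\<close> be a vertex of maximal weighted degree, \<open>B\<close> its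
  neighbourhood in \<open>E\<close> and \<open>A\<close> the complement of \<open>B\<close>. The edges meeting \<open>A\<close> weigh at most
  $y(A)$ times the link of \<open>v\<close>; that link and the edges inside \<open>B\<close> satisfy the same hypothesis
  with $k-1$ in place of $k$. By induction every vector $y \ge 0$ gives the edges total weight at most
  $\binom{k}{r} (\sum y / k)^r$, and near equality with $y = 1$ forces \<open>H\<close> to be close to a balanced
  complete $k$-partite $r$-graph. Finally, Hoelder's inequality together with this bound at
  $y = |x|^p$ turns a large $\lambda^{(p)}$ into an almost extremal number of edges.
\<close>

subsection \<open>The weighted extremal bound\<close>

text \<open>Heaviness counts edges of the whole hypergraph and would not survive the passage to
  links and neighbourhoods. The graph \<open>E\<close> is therefore carried as a separate object,
  and \<open>clique_limited\<close> is a condition on the pair that both operations inherit. The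
  induction step comes down to one variable: the ratio between the weight of B and its ideal share.
  The estimate loses the square of the deviation of this ratio from 1, and that loss later controls
  the part sizes. A second gain is that summing over A counts an edge with two vertices in A at
  least twice, so such edges are rare near the extremum. Weights are needed only for the upper
  bound, because Hoelder leaves the edge polynomial at |x|^p. Once this bound is available, a large
  spectral radius forces many edges whatever x is, so stability is needed for unit weights only. The
  assumption p > 1 enters through 1 - 1/p > 0: the deleted edges contribute a power of their number
  with this exponent, which is of lower order than the main term.\<close>

definition clique :: "('a \<Rightarrow> 'a \<Rightarrow> bool) \<Rightarrow> 'a set \<Rightarrow> bool" where
  "clique E Q \<longleftrightarrow> (\<forall>x\<in>Q. \<forall>y\<in>Q. x \<noteq> y \<longrightarrow> E x y)"

text \<open>Only cliques containing an edge of \<open>H\<close> are bounded, because a copy of the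
  forbidden hypergraph needs an edge for its core [r]. An edge is itself such a clique, so
  \<open>H\<close> is empty when \<open>k < r\<close>.\<close>

definition clique_limited ::
  "nat \<Rightarrow> nat \<Rightarrow> 'a set \<Rightarrow> ('a \<Rightarrow> 'a \<Rightarrow> bool) \<Rightarrow> 'a set set \<Rightarrow> bool" where
  "clique_limited k r V E H \<longleftrightarrow> finite V \<and> symp E \<and>
     (\<forall>e\<in>H. e \<subseteq> V \<and> card e = r \<and> clique E e) \<and>
     (\<forall>Q e. Q \<subseteq> V \<longrightarrow> clique E Q \<longrightarrow> e \<in> H \<longrightarrow> e \<subseteq> Q \<longrightarrow> card Q \<le> k)"

definition link :: "'a \<Rightarrow> 'a set set \<Rightarrow> 'a set set" where
  "link v H = {f. v \<notin> f \<and> insert v f \<in> H}"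

definition weight :: "('a \<Rightarrow> real) \<Rightarrow> 'a set set \<Rightarrow> real" where
  "weight y H = (\<Sum>e\<in>H. \<Prod>v\<in>e. y v)"

definition nbrs :: "'a set \<Rightarrow> ('a \<Rightarrow> 'a \<Rightarrow> bool) \<Rightarrow> 'a \<Rightarrow> 'a set" where
  "nbrs V E v = {u\<in>V. u \<noteq> v \<and> E v u}"

text \<open>The Lagrangian of the complete r-graph on k vertices, equivalently the limit of the
  number of edges of T_r(n,k) divided by n^r. At \<open>k = r = 0\<close> it equals 1, as the
  induction base requires.\<close>

definition turan_density :: "nat \<Rightarrow> nat \<Rightarrow> real" where
  "turan_density k r = real (k choose r) / real k ^ r"

lemma weight_const_1: "weight (\<lambda>_. 1) H = real (card H)"
  by (simp add: weight_def)

lemma clique_limitedD: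
  assumes "clique_limited k r V E H"
  shows "finite V" "symp E" "\<And>e. e \<in> H \<Longrightarrow> e \<subseteq> V" "\<And>e. e \<in> H \<Longrightarrow> card e = r"
    "\<And>e. e \<in> H \<Longrightarrow> clique E e"
    "\<And>Q e. Q \<subseteq> V \<Longrightarrow> clique E Q \<Longrightarrow> e \<in> H \<Longrightarrow> e \<subseteq> Q \<Longrightarrow> card Q \<le> k"
  using assms by (auto simp: clique_limited_def)

lemma clique_limited_finite:
  assumes "clique_limited k r V E H"
  shows "finite H" "\<And>e. e \<in> H \<Longrightarrow> finite e"
proof -
  have "H \<subseteq> Pow V" using clique_limitedD(3)[OF assms] by auto
  then show "finite H" using clique_limitedD(1)[OF assms] by (meson finite_Pow_iff finite_subset)
  show "finite e" if "e \<in> H" for e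
    using that clique_limitedD(1,3)[OF assms] by (auto intro: finite_subset)
qed

lemma clique_limited_empty:
  assumes "clique_limited k r V E H" "k < r"
  shows "H = {}"
proof (rule ccontr)
  assume "H \<noteq> {}"
  then obtain e where e: "e \<in> H" by blast
  have "card e \<le> k"
    using clique_limitedD(6)[OF assms(1) clique_limitedD(3,5)[OF assms(1) e] e] by simp
  then show False using clique_limitedD(4)[OF assms(1) e] assms(2) by simp
qed

lemma clique_insert_nbrs:
  assumes "symp E" "clique E Q" "Q \<subseteq> nbrs V E v"
  shows "clique E (insert v Q)"
  using assms unfolding clique_def nbrs_def symp_def by blast

text \<open>A clique inside the neighbourhood of \<open>v\<close> stays a clique when
  \<open>v\<close> is added, which lowers the clique bound by one.\<close>

lemma clique_limited_nbrs:
  assumes "clique_limited (Suc k) r V E H" "v \<in> V"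
  shows "clique_limited k r (nbrs V E v) E {e\<in>H. e \<subseteq> nbrs V E v}"
  unfolding clique_limited_def
proof (intro conjI allI impI ballI)
  note D = clique_limitedD[OF assms(1)]
  show "finite (nbrs V E v)" using D(1) by (simp add: nbrs_def)
  show "symp E" by (rule D(2))
  fix Q e assume Q: "Q \<subseteq> nbrs V E v" "clique E Q" and e: "e \<in> {e\<in>H. e \<subseteq> nbrs V E v}" "e \<subseteq> Q"
  have "card (insert v Q) \<le> Suc k"
    by (rule D(6)[where e = e]) (use Q e assms clique_insert_nbrs[OF D(2) Q(2,1)] in \<open>auto simp: nbrs_def\<close>)
  moreover have "v \<notin> Q" "finite Q" using Q \<open>finite (nbrs V E v)\<close> by (auto simp: nbrs_def intro: finite_subset)
  ultimately show "card Q \<le> k" by simp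
qed (use clique_limitedD[OF assms(1)] in auto)

text \<open>Adding \<open>v\<close> now enlarges both the clique and the edge, so uniformity and
  clique bound drop together.\<close>

lemma clique_limited_link:
  assumes "clique_limited (Suc k) (Suc r) V E H" "v \<in> V"
  shows "clique_limited k r (nbrs V E v) E (link v H)"
  unfolding clique_limited_def
proof (intro conjI allI impI ballI)
  note D = clique_limitedD[OF assms(1)]
  show fin: "finite (nbrs V E v)" using D(1) by (simp add: nbrs_def)
  show "symp E" by (rule D(2))
  fix f assume f: "f \<in> link v H"
  then have f': "v \<notin> f" "insert v f \<in> H" by (auto simp: link_def)
  show "f \<subseteq> nbrs V E v"
  proof
    fix u assume "u \<in> f"
    then show "u \<in> nbrs V E v"
      using f' D(3)[OF f'(2)] D(5)[OF f'(2)] by (auto simp: clique_def nbrs_def)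
  qed
  have "finite f" using fin \<open>f \<subseteq> nbrs V E v\<close> by (rule finite_subset[rotated])
  then show "card f = r" using f' D(4)[OF f'(2)] by simp
  show "clique E f" using D(5)[OF f'(2)] by (simp add: clique_def)
next
  note D = clique_limitedD[OF assms(1)]
  fix Q f assume Q: "Q \<subseteq> nbrs V E v" "clique E Q" and f: "f \<in> link v H" "f \<subseteq> Q"
  have "card (insert v Q) \<le> Suc k"
    by (rule D(6)[where e = "insert v f"])
      (use Q f assms clique_insert_nbrs[OF D(2) Q(2,1)] in \<open>auto simp: nbrs_def link_def\<close>)
  moreover have "v \<notin> Q" "finite Q" using Q D(1) by (auto simp: nbrs_def intro: finite_subset)
  ultimately show "card Q \<le> k" by simp
qed

section \<open>Links and a vertex of maximal weighted degree\<close>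

lemma sum_weight_link:
  assumes "finite A" "finite H" "\<And>e. e \<in> H \<Longrightarrow> finite e"
  shows "(\<Sum>a\<in>A. y a * weight y (link a H)) = (\<Sum>e\<in>H. real (card (e \<inter> A)) * (\<Prod>v\<in>e. y v))"
proof -
  have "y a * weight y (link a H) = (\<Sum>e\<in>{e\<in>H. a \<in> e}. \<Prod>v\<in>e. y v)" for a
  proof -
    have "y a * weight y (link a H) = (\<Sum>f\<in>link a H. y a * (\<Prod>v\<in>f. y v))"
      by (simp add: weight_def sum_distrib_left)
    also have "\<dots> = (\<Sum>f\<in>link a H. \<Prod>v\<in>insert a f. y v)"
    proof (rule sum.cong[OF refl])
      fix f assume "f \<in> link a H"
      then have "a \<notin> f" "finite f" using assms(3)[of "insert a f"] by (auto simp: link_def)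
      then show "y a * (\<Prod>v\<in>f. y v) = (\<Prod>v\<in>insert a f. y v)" by simp
    qed
    also have "\<dots> = (\<Sum>e\<in>{e\<in>H. a \<in> e}. \<Prod>v\<in>e. y v)"
      by (rule sum.reindex_bij_witness[where i = "\<lambda>e. e - {a}" and j = "insert a"])
        (auto simp: link_def insert_absorb)
    finally show ?thesis .
  qed
  then have "(\<Sum>a\<in>A. y a * weight y (link a H)) = (\<Sum>a\<in>A. \<Sum>e\<in>{e\<in>H. a \<in> e}. \<Prod>v\<in>e. y v)"
    by simp
  also have "\<dots> = (\<Sum>e\<in>H. \<Sum>a\<in>{a\<in>A. a \<in> e}. \<Prod>v\<in>e. y v)"
    by (rule sum.swap_restrict[OF assms(1,2)])
  also have "\<dots> = (\<Sum>e\<in>H. real (card (e \<inter> A)) * (\<Prod>v\<in>e. y v))"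
    by (intro sum.cong refl) (simp add: Int_def conj_commute)
  finally show ?thesis .
qed

text \<open>With A the complement of the neighbourhood of \<open>v\<close>, maximality bounds the
  sum of \<open>y a * weight y (link a H)\<close> over A by y(A) times the link of \<open>v\<close>.
  By \<open>sum_weight_link\<close> that sum counts an edge as often as it meets A: at least once if
  it is not inside the neighbourhood, at least twice if it has two vertices in A. The second count
  is the surplus term on the left.\<close>

lemma max_link_pivot:
  assumes "clique_limited k r V E H" "V \<noteq> {}" "\<And>v. v \<in> V \<Longrightarrow> y v \<ge> 0"
  obtains v where "v \<in> V"
    "weight y H + weight y {e\<in>H. card (e - nbrs V E v) \<ge> 2}
      \<le> sum y (V - nbrs V E v) * weight y (link v H) + weight y {e\<in>H. e \<subseteq> nbrs V E v}"
proof -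
  note D = clique_limitedD[OF assms(1)]
  note F = clique_limited_finite[OF assms(1)]
  obtain v where v: "v \<in> V" "\<And>a. a \<in> V \<Longrightarrow> weight y (link a H) \<le> weight y (link v H)"
  proof -
    let ?W = "(\<lambda>a. weight y (link a H)) ` V"
    have "Max ?W \<in> ?W" using assms(2) D(1) by (intro Max_in) auto
    then obtain v where "v \<in> V" "Max ?W = weight y (link v H)" by blast
    moreover have "weight y (link a H) \<le> Max ?W" if "a \<in> V" for a
      using that D(1) by (intro Max_ge) auto
    ultimately show ?thesis using that by metis
  qed
  define B where "B = nbrs V E v"
  let ?P = "\<lambda>e. \<Prod>v\<in>e. y v"
  have pos: "?P e \<ge> 0" if "e \<in> H" for e
    using D(3)[OF that] assms(3) by (intro prod_nonneg) auto
  have "weight y H + weight y {e\<in>H. card (e - B) \<ge> 2} - weight y {e\<in>H. e \<subseteq> B}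
      = (\<Sum>e\<in>H. ?P e + (if card (e - B) \<ge> 2 then ?P e else 0) - (if e \<subseteq> B then ?P e else 0))"
    using F(1) by (simp add: weight_def sum.distrib sum_subtractf sum.If_cases Int_def conj_commute)
  also have "\<dots> \<le> (\<Sum>e\<in>H. real (card (e \<inter> (V - B))) * ?P e)"
  proof (rule sum_mono)
    fix e assume e: "e \<in> H"
    have eq: "e \<inter> (V - B) = e - B" using D(3)[OF e] by blast
    have "?P e + (if card (e - B) \<ge> 2 then ?P e else 0) - (if e \<subseteq> B then ?P e else 0)
        = (1 + (if card (e - B) \<ge> 2 then 1 else 0) - (if e \<subseteq> B then 1 else 0)) * ?P e"
      by (simp add: algebra_simps)
    also have "\<dots> \<le> real (card (e - B)) * ?P e"
    proof (rule mult_right_mono[OF _ pos[OF e]])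
      have "card (e - B) \<ge> 1" if "\<not> e \<subseteq> B"
        using that F(2)[OF e] by (simp add: Suc_le_eq card_gt_0_iff)
      then show "1 + (if card (e - B) \<ge> 2 then 1 else 0) - (if e \<subseteq> B then 1 else 0) \<le> real (card (e - B))"
        by (cases "e \<subseteq> B") (auto simp: Diff_eq_empty_iff[THEN iffD2])
    qed
    finally show "?P e + (if card (e - B) \<ge> 2 then ?P e else 0) - (if e \<subseteq> B then ?P e else 0)
        \<le> real (card (e \<inter> (V - B))) * ?P e" by (simp add: eq)
  qed
  also have "\<dots> = (\<Sum>a\<in>V - B. y a * weight y (link a H))"
    using sum_weight_link[of "V - B" H y] D(1) F by simp
  also have "\<dots> \<le> (\<Sum>a\<in>V - B. y a * weight y (link v H))"
    using v assms(3) by (intro sum_mono mult_left_mono) auto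
  also have "\<dots> = sum y (V - B) * weight y (link v H)" by (simp add: sum_distrib_right)
  finally have "weight y H + weight y {e\<in>H. card (e - B) \<ge> 2}
      \<le> sum y (V - B) * weight y (link v H) + weight y {e\<in>H. e \<subseteq> B}" by simp
  then show ?thesis using that v(1) by (simp add: B_def)
qed

text \<open>With s = r + 2, the left side s u^(s-1) - (s-1) u^s attains its maximum 1 at u = 1. For
  s = 2 equality holds, and raising s by one lowers it by s u^(s-1) (u-1)^2.\<close>

lemma power_gap:
  fixes u :: real
  assumes "u \<ge> 0"
  shows "real (r + 2) * u ^ (r + 1) - real (r + 1) * u ^ (r + 2) \<le> 1 - (u - 1)\<^sup>2"
proof (induction r)
  case 0
  then show ?case by (simp add: power2_eq_square algebra_simps)
next
  case (Suc r)
  have "0 \<le> real (r + 2) * u ^ (r + 1) * (u - 1)\<^sup>2" using assms by simp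
  also have "\<dots> = (real (r + 2) * u ^ (r + 1) - real (r + 1) * u ^ (r + 2))
      - (real (Suc r + 2) * u ^ (Suc r + 1) - real (Suc r + 1) * u ^ (Suc r + 2))"
    by (simp add: power2_eq_square algebra_simps)
  finally show ?case using Suc by linarith
qed

lemma turan_density_pos: "r \<le> k \<Longrightarrow> turan_density k r > 0"
  by (cases "k = 0") (auto simp: turan_density_def zero_less_binomial_iff)

lemma turan_density_nonneg: "turan_density k r \<ge> 0"
  by (simp add: turan_density_def)

text \<open>Here \<open>a\<close> and \<open>b\<close> are the weights of A and B. With u = (k+1) b
  / (k (a+b)) and n = a + b, the left side is exactly the new density times n^(r+1) times (r+1) u^r
  - r u^(r+1). The value u = 1 means that A has its ideal share n/(k+1).\<close>

lemma turan_step_bound: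
  fixes a b :: real
  assumes "a \<ge> 0" "b \<ge> 0" "a + b > 0" "r \<ge> 1" "k \<ge> r"
  shows "a * (turan_density k r * b ^ r) + turan_density k (Suc r) * b ^ Suc r
     \<le> turan_density (Suc k) (Suc r) * (a + b) ^ Suc r
         * (1 - (real (Suc k) * b / (real k * (a + b)) - 1)\<^sup>2)"
proof -
  define n where "n = a + b"
  define u where "u = real (Suc k) * b / (real k * n)"
  obtain q where q: "r = Suc q" using assms(4) by (metis Suc_le_D One_nat_def)
  have n: "n > 0" and k: "real k > 0" using assms by (auto simp: n_def)
  have u: "u \<ge> 0" using assms n by (simp add: u_def)
  have a: "a = n - b" by (simp add: n_def)
  let ?C = "real (k choose r)"
  have C1: "real (k choose Suc r) = ?C * (real k - real r) / real (Suc r)"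
  proof -
    have "Suc r * (k choose Suc r) = (k choose r) * (k - r)"
      using binomial_absorption[of r "k"] by (metis binomial_absorb_comp mult.commute)
    then have "real (Suc r) * real (k choose Suc r) = ?C * real (k - r)" by (metis of_nat_mult)
    then show ?thesis using assms(5) by (simp add: of_nat_diff field_simps)
  qed
  have C2: "real (Suc k choose Suc r) = real (Suc k) * ?C / real (Suc r)"
  proof -
    have "Suc r * (Suc k choose Suc r) = Suc k * (k choose r)" by (rule Suc_times_binomial)
    then have "real (Suc r) * real (Suc k choose Suc r) = real (Suc k) * ?C" by (metis of_nat_mult)
    then show ?thesis by (simp add: field_simps)
  qed
  \<comment> \<open>The weight of each part when B is split into k equal parts; a density times a
    power of \<open>b\<close> becomes a binomial coefficient times a power of
    \<open>s\<close>.\<close>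
  define s where "s = b / real k"
  have bs: "b = real k * s" using k by (simp add: s_def)
  have s: "s = u * n / real (Suc k)" using n k by (simp add: s_def u_def del: of_nat_Suc)
  have L: "a * (turan_density k r * b ^ r) + turan_density k (Suc r) * b ^ Suc r
     = ?C * s ^ r * (a + s * (real k - real r) / real (Suc r))"
  proof -
    have "turan_density k m * b ^ m = real (k choose m) * s ^ m" for m
      using k by (simp add: turan_density_def bs power_mult_distrib)
    from this[of r] this[of "Suc r"] show ?thesis
      by (simp only: C1) (simp add: algebra_simps add_divide_distrib diff_divide_distrib)
  qed
  also have "a + s * (real k - real r) / real (Suc r) = n - s * real (Suc k) * real r / real (Suc r)"
    unfolding a bs by (simp add: field_simps)
  also have "\<dots> = n / real (Suc r) * (real (Suc r) - u * real r)"
    by (simp add: s field_simps del: of_nat_Suc)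
  also have "?C * s ^ r * (n / real (Suc r) * (real (Suc r) - u * real r))
    = ?C * n ^ Suc r / (real (Suc r) * real (Suc k) ^ r) * (real (Suc r) * u ^ r - real r * u ^ Suc r)"
    by (simp add: s field_simps power_divide power_mult_distrib del: of_nat_Suc)
  also have "?C * n ^ Suc r / (real (Suc r) * real (Suc k) ^ r) = turan_density (Suc k) (Suc r) * n ^ Suc r"
    unfolding turan_density_def C2 by (simp add: field_simps del: of_nat_Suc)
  \<comment> \<open>The last factor is that of \<open>power_gap\<close> at \<open>q = r - 1\<close>,
    which is where \<open>r \<ge> 1\<close> is used.\<close>
  also have "turan_density (Suc k) (Suc r) * n ^ Suc r * (real (Suc r) * u ^ r - real r * u ^ Suc r)
     \<le> turan_density (Suc k) (Suc r) * n ^ Suc r * (1 - (u - 1)\<^sup>2)"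
    using power_gap[OF u, of q] n turan_density_nonneg
    by (intro mult_left_mono) (auto simp: q)
  finally show ?thesis by (simp add: n_def u_def)
qed

text \<open>A hypergraph analogue of the Motzkin-Straus theorem. Both recursive calls lower k, but
  only the link lowers r, so r is generalised. Uniformities 0 and 1 are treated directly, since
  \<open>turan_step_bound\<close> requires a link of positive uniformity.\<close>

lemma weight_clique_limited_le:
  assumes "clique_limited k r V E H" "\<And>v. v \<in> V \<Longrightarrow> y v \<ge> 0"
  shows "weight y H \<le> turan_density k r * sum y V ^ r"
  using assms
proof (induction k arbitrary: r V H)
  case (0 r V H)
  show ?case
  proof (cases r)
    case 0
    have "H \<subseteq> {{}}" using clique_limitedD(4)[OF "0.prems"(1)] clique_limited_finite[OF "0.prems"(1)] 0 by auto
    then have "H = {} \<or> H = {{}}" by blast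
    then show ?thesis using 0 by (auto simp: weight_def turan_density_def)
  next
    case (Suc q)
    then have "H = {}" using clique_limited_empty[OF "0.prems"(1)] by simp
    then show ?thesis using Suc by (simp add: weight_def turan_density_def)
  qed
next
  case (Suc k r V H)
  note D = clique_limitedD[OF Suc.prems(1)]
  have S0: "sum y V \<ge> 0" using Suc.prems(2) by (rule sum_nonneg)
  consider "r = 0" | "r = 1" | "r \<ge> 2" "Suc k < r" | "r \<ge> 2" "r \<le> Suc k" by linarith
  then show ?case
  proof cases
    case 1
    have "H \<subseteq> {{}}" using D(4) clique_limited_finite[OF Suc.prems(1)] 1 by auto
    then have "H = {} \<or> H = {{}}" by blast
    then show ?thesis using 1 by (auto simp: weight_def turan_density_def)
  next
    case 2
    have "H \<subseteq> (\<lambda>v. {v}) ` V" 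
      
    proof
      fix e assume e: "e \<in> H"
      then obtain v where "e = {v}" using D(4)[OF e] 2 by (auto simp: card_1_singleton_iff)
      then show "e \<in> (\<lambda>v. {v}) ` V" using D(3)[OF e] by auto
    qed
    then have "weight y H \<le> (\<Sum>e\<in>(\<lambda>v. {v}) ` V. \<Prod>v\<in>e. y v)"
      unfolding weight_def using D(1) Suc.prems(2) by (intro sum_mono2) auto
    also have "\<dots> = sum y V" by (subst sum.reindex) auto
    finally show ?thesis using 2 by (simp add: turan_density_def)
  next
    case 3
    then show ?thesis using clique_limited_empty[OF Suc.prems(1)] S0
      by (simp add: weight_def turan_density_nonneg)
  next
    case 4
    obtain q where q: "r = Suc q" "q \<ge> 1" "q \<le> k" using 4 by (cases r) auto
    show ?thesis
    \<comment> \<open>\<open>turan_step_bound\<close> divides by the total weight.\<close>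
    proof (cases "sum y V = 0")
      case True
      then have "y v = 0" if "v \<in> V" for v using that Suc.prems(2) D(1) by (simp add: sum_nonneg_eq_0_iff)
      moreover have "\<exists>v. v \<in> e" if "e \<in> H" for e
        using D(4)[OF that] q by (metis card.empty ex_in_conv nat.simps(3))
      ultimately have "(\<Prod>v\<in>e. y v) = 0" if "e \<in> H" for e
        using that D(3)[OF that] clique_limited_finite(2)[OF Suc.prems(1) that]
        by (meson prod_zero subsetD)
      then show ?thesis using True q by (simp add: weight_def)
    next
      case False
      then have ne: "V \<noteq> {}" by auto
      obtain v where v: "v \<in> V" and vb:
        "weight y H + weight y {e\<in>H. card (e - nbrs V E v) \<ge> 2}
         \<le> sum y (V - nbrs V E v) * weight y (link v H) + weight y {e\<in>H. e \<subseteq> nbrs V E v}"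
        using max_link_pivot[where y = y, OF Suc.prems(1) ne Suc.prems(2)] by blast
      define B where "B = nbrs V E v"
      have BV: "B \<subseteq> V" by (auto simp: B_def nbrs_def)
      have yB: "\<And>v. v \<in> B \<Longrightarrow> y v \<ge> 0" using BV Suc.prems(2) by auto
      have ab: "sum y (V - B) + sum y B = sum y V"
        using sum.subset_diff[OF BV D(1), of y] by simp
      have a0: "sum y (V - B) \<ge> 0" and b0: "sum y B \<ge> 0"
        using Suc.prems(2) BV by (auto intro!: sum_nonneg)
      have "weight y {e\<in>H. card (e - B) \<ge> 2} \<ge> 0"
        unfolding weight_def using D(3) Suc.prems(2) by (intro sum_nonneg prod_nonneg) blast
      then have "weight y H \<le> sum y (V - B) * weight y (link v H) + weight y {e\<in>H. e \<subseteq> B}"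
        using vb by (simp add: B_def)
      also have "\<dots> \<le> sum y (V - B) * (turan_density k q * sum y B ^ q) + turan_density k (Suc q) * sum y B ^ Suc q"
        using Suc.IH[OF clique_limited_nbrs[OF Suc.prems(1) v]] Suc.IH[OF clique_limited_link[OF Suc.prems(1)[unfolded q] v]]
          yB a0 unfolding q B_def by (intro add_mono mult_left_mono) auto
      also have "\<dots> \<le> turan_density (Suc k) (Suc q) * (sum y (V - B) + sum y B) ^ Suc q
         * (1 - (real (Suc k) * sum y B / (real k * (sum y (V - B) + sum y B)) - 1)\<^sup>2)"
        using False S0 ab by (intro turan_step_bound a0 b0 q(2,3)) auto
      also have "\<dots> \<le> turan_density (Suc k) (Suc q) * (sum y (V - B) + sum y B) ^ Suc q * 1"
        using turan_density_nonneg ab S0 by (intro mult_left_mono mult_nonneg_nonneg) auto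
      finally show ?thesis using ab q by simp
    qed
  qed
qed

lemma card_clique_limited_le:
  assumes "clique_limited k r V E H"
  shows "real (card H) \<le> turan_density k r * real (card V) ^ r"
  using weight_clique_limited_le[OF assms, of "\<lambda>_. 1"] by (simp add: weight_const_1)

subsection \<open>Colourings and rainbow edges\<close>

lemma binomial_le_power: "n choose r \<le> n ^ r"
  by (cases "r \<le> n") (auto intro: binomial_le_pow simp: binomial_eq_0)

lemma card_supersets_le:
  assumes "finite V" "finite M" "\<And>m. m \<in> M \<Longrightarrow> m \<subseteq> V \<and> card m = s"
  shows "card {X. X \<subseteq> V \<and> card X = t \<and> (\<exists>m\<in>M. m \<subseteq> X)} \<le> card M * card V ^ (t - s)"
proof -
  let ?D = "{D. D \<subseteq> V \<and> card D = t - s}"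
  have finD: "finite ?D" using assms(1) by simp
  have "card ?D = card V choose (t - s)" using n_subsets[OF assms(1)] .
  also have "\<dots> \<le> card V ^ (t - s)" by (rule binomial_le_power)
  finally have D: "card ?D \<le> card V ^ (t - s)" .
  have "{X. X \<subseteq> V \<and> card X = t \<and> (\<exists>m\<in>M. m \<subseteq> X)} \<subseteq> (\<lambda>(m, D). m \<union> D) ` (M \<times> ?D)"
  proof
    fix X assume "X \<in> {X. X \<subseteq> V \<and> card X = t \<and> (\<exists>m\<in>M. m \<subseteq> X)}"
    then obtain m where X: "X \<subseteq> V" "card X = t" "m \<in> M" "m \<subseteq> X" by blast
    have "card (X - m) = t - s"
      using X assms by (metis card_Diff_subset finite_subset)
    then have "X - m \<in> ?D" using X by auto
    moreover have "X = m \<union> (X - m)" using X by blast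
    ultimately show "X \<in> (\<lambda>(m, D). m \<union> D) ` (M \<times> ?D)" using X by (auto intro!: image_eqI[where x = "(m, X - m)"])
  qed
  then have "card {X. X \<subseteq> V \<and> card X = t \<and> (\<exists>m\<in>M. m \<subseteq> X)} \<le> card (M \<times> ?D)"
    using assms(2) finD by (meson finite_SigmaI surj_card_le)
  also have "\<dots> \<le> card M * card V ^ (t - s)" using D by (simp add: card_cartesian_product)
  finally show ?thesis .
qed

text \<open>The complete multipartite r-graph whose parts are the colour classes. Encoding the parts
  by a colouring makes them disjoint and covering automatically, and moving a vertex becomes a
  function update.\<close>

definition rainbow :: "'a set \<Rightarrow> ('a \<Rightarrow> nat) \<Rightarrow> nat \<Rightarrow> 'a set set" where
  "rainbow V c r = {e. e \<subseteq> V \<and> card e = r \<and> inj_on c e}"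

lemma finite_rainbow: "finite V \<Longrightarrow> finite (rainbow V c r)"
  by (rule finite_subset[of _ "Pow V"]) (auto simp: rainbow_def)

text \<open>For the relation of having different colours, a clique is an injectively coloured set.
  The general extremal bound thus also bounds multipartite hypergraphs, with no computation of part
  products.\<close>

lemma clique_limited_rainbow:
  assumes "finite V" "c ` V \<subseteq> I" "finite I" "card I \<le> k"
  shows "clique_limited k r V (\<lambda>x y. c x \<noteq> c y) (rainbow V c r)"
  unfolding clique_limited_def
proof (intro conjI allI impI ballI)
  show "symp (\<lambda>x y. c x \<noteq> c y)" by (auto simp: symp_def)
  fix Q e assume Q: "Q \<subseteq> V" "clique (\<lambda>x y. c x \<noteq> c y) Q"
  have "card Q = card (c ` Q)"
    using Q(2) by (intro card_image[symmetric]) (auto simp: clique_def inj_on_def)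
  also have "\<dots> \<le> card I" using Q(1) assms by (intro card_mono) auto
  finally show "card Q \<le> k" using assms by simp
qed (use assms in \<open>auto simp: rainbow_def clique_def inj_on_def\<close>)

text \<open>The split of the induction step with A a colour class: a rainbow edge meets A in at most
  one vertex. \<open>turan_step_bound\<close> then charges a quadratic loss for any deviation of |A|
  from n/(k+1).\<close>

lemma card_rainbow_le_class:
  assumes "finite V" "\<And>v. v \<in> V \<Longrightarrow> c v < Suc k" "i < Suc k" "r \<ge> 1" "k \<ge> r" "V \<noteq> {}"
  defines "A \<equiv> {v\<in>V. c v = i}"
  shows "real (card (rainbow V c (Suc r))) \<le> turan_density (Suc k) (Suc r) * real (card V) ^ Suc r
     * (1 - (real (Suc k) * real (card (V - A)) / (real k * real (card V)) - 1)\<^sup>2)"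
proof -
  define B where "B = V - A"
  have AV: "A \<subseteq> V" and fA: "finite A" and fB: "finite B" using assms(1) by (auto simp: A_def B_def)
  have n: "real (card A) + real (card B) = real (card V)"
    using card_Diff_subset[OF fA AV] card_mono[OF assms(1) AV] by (simp add: B_def)
  \<comment> \<open>Only k of the k+1 colours occur outside A, which gives clique bound
    \<open>k\<close> on B.\<close>
  have cB: "c ` B \<subseteq> {..<Suc k} - {i}" using assms(2) by (auto simp: B_def A_def)
  have lim: "clique_limited k q B (\<lambda>x y. c x \<noteq> c y) (rainbow B c q)" for q
    by (rule clique_limited_rainbow[OF fB cB]) (use assms(3) in auto)
  have "rainbow V c (Suc r) \<subseteq> (\<lambda>(a, f). insert a f) ` (A \<times> rainbow B c r) \<union> rainbow B c (Suc r)"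
  proof
    fix e assume e: "e \<in> rainbow V c (Suc r)"
    then have e': "e \<subseteq> V" "card e = Suc r" "inj_on c e" by (auto simp: rainbow_def)
    show "e \<in> (\<lambda>(a, f). insert a f) ` (A \<times> rainbow B c r) \<union> rainbow B c (Suc r)"
    proof (cases "e \<inter> A = {}")
      case True
      then show ?thesis using e' by (auto simp: rainbow_def B_def)
    next
      case False
      then obtain a where a: "a \<in> e" "a \<in> A" by blast
      have "e - {a} \<subseteq> B"
      proof
        fix x assume x: "x \<in> e - {a}"
        have "c x \<noteq> c a" using e'(3) x a by (auto dest: inj_onD)
        then show "x \<in> B" using x e' a by (auto simp: B_def A_def)
      qed
      moreover have "card (e - {a}) = r" using e' a by simp
      moreover have "inj_on c (e - {a})" using e'(3) by (rule inj_on_subset) auto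
      ultimately have "e - {a} \<in> rainbow B c r" by (simp add: rainbow_def)
      then show ?thesis using a by (intro UnI1 image_eqI[where x = "(a, e - {a})"]) auto
    qed
  qed
  then have "card (rainbow V c (Suc r))
      \<le> card ((\<lambda>(a, f). insert a f) ` (A \<times> rainbow B c r) \<union> rainbow B c (Suc r))"
    by (rule card_mono[rotated]) (use fA fB in \<open>simp add: finite_rainbow\<close>)
  also have "\<dots> \<le> card ((\<lambda>(a, f). insert a f) ` (A \<times> rainbow B c r)) + card (rainbow B c (Suc r))"
    by (rule card_Un_le)
  also have "card ((\<lambda>(a, f). insert a f) ` (A \<times> rainbow B c r)) \<le> card (A \<times> rainbow B c r)"
    by (rule card_image_le) (use fA fB in \<open>simp add: finite_rainbow\<close>)
  finally have "card (rainbow V c (Suc r)) \<le> card A * card (rainbow B c r) + card (rainbow B c (Suc r))"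
    by (simp add: card_cartesian_product)
  then have "real (card (rainbow V c (Suc r)))
      \<le> real (card A) * real (card (rainbow B c r)) + real (card (rainbow B c (Suc r)))"
    by (metis of_nat_add of_nat_le_iff of_nat_mult)
  also have "\<dots> \<le> real (card A) * (turan_density k r * real (card B) ^ r)
      + turan_density k (Suc r) * real (card B) ^ Suc r"
    by (intro add_mono mult_left_mono card_clique_limited_le[OF lim]) auto
  also have "\<dots> \<le> turan_density (Suc k) (Suc r) * (real (card A) + real (card B)) ^ Suc r
         * (1 - (real (Suc k) * real (card B) / (real k * (real (card A) + real (card B))) - 1)\<^sup>2)"
    by (rule turan_step_bound) (use n assms in \<open>auto simp: card_gt_0_iff\<close>)
  finally show ?thesis unfolding n unfolding B_def .
qed

text \<open>Inverts the quadratic loss: the squared deviation is at most \<delta>/D. Rescaling from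
  the ratio to \<open>a\<close> gives a factor k/(k+1), estimated by 1. The number \<open>m\<close>
  stands for the normalising power of n.\<close>

lemma near_max_part_size:
  fixes a n D \<delta> m :: real and k :: nat
  assumes "n > 0" "D > 0" "\<delta> \<ge> 0" "m > 0" "k \<ge> 1"
    and "(D - \<delta>) * m \<le> D * m * (1 - (real (Suc k) * (n - a) / (real k * n) - 1)\<^sup>2)"
  shows "\<bar>a - n / real (Suc k)\<bar> \<le> sqrt (\<delta> / D) * n"
proof -
  let ?w = "real (Suc k) * (n - a) / (real k * n) - 1"
  have "D * m * ?w\<^sup>2 \<le> \<delta> * m" using assms(6) by (simp add: algebra_simps)
  then have "D * ?w\<^sup>2 \<le> \<delta>"
    using assms(4) by (metis mult.assoc mult.commute mult_le_cancel_left_pos)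
  then have "?w\<^sup>2 \<le> \<delta> / D" using assms(2) by (simp add: field_simps)
  then have w: "\<bar>?w\<bar> \<le> sqrt (\<delta> / D)" by (metis real_sqrt_abs real_sqrt_le_iff)
  have "?w = (n / real (Suc k) - a) * (real (Suc k) / (real k * n))"
  proof -
    have "(q + 1) * (n - a) / (q * n) - 1 = (n / (q + 1) - a) * ((q + 1) / (q * n))" if "q > 0" for q
    proof -
      have "q + 1 \<noteq> 0" "q * n \<noteq> 0" using that assms(1) by auto
      then have "(n / (q + 1) - a) * ((q + 1) / (q * n)) = (n - a * (q + 1)) / (q * n)"
        by (simp add: divide_simps)
      also have "\<dots> = ((q + 1) * (n - a) - q * n) / (q * n)" by (simp add: algebra_simps)
      also have "\<dots> = (q + 1) * (n - a) / (q * n) - 1"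
        using \<open>q * n \<noteq> 0\<close> by (simp add: diff_divide_distrib)
      finally show ?thesis by simp
    qed
    from this[of "real k"] show ?thesis using assms(5) by (simp add: add.commute)
  qed
  then have "\<bar>a - n / real (Suc k)\<bar> * (real (Suc k) / (real k * n)) = \<bar>?w\<bar>"
    using assms(1,5) by (simp add: abs_mult abs_minus_commute)
  then have "\<bar>a - n / real (Suc k)\<bar> = \<bar>?w\<bar> / (real (Suc k) / (real k * n))"
    using assms(1,5) by (intro nonzero_eq_divide_eq[THEN iffD2]) auto
  also have "\<dots> = \<bar>?w\<bar> * (real k / real (Suc k)) * n" by simp
  also have "\<dots> \<le> sqrt (\<delta> / D) * 1 * n"
    using w assms by (intro mult_mono) auto
  finally show ?thesis by simp
qed

lemma rainbow_class_size:
  assumes "finite V" "\<And>v. v \<in> V \<Longrightarrow> c v < k" "i < k" "2 \<le> r" "r \<le> k" "\<delta> \<ge> 0"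
    and "real (card (rainbow V c r)) \<ge> (turan_density k r - \<delta>) * real (card V) ^ r"
  shows "\<bar>real (card {v\<in>V. c v = i}) - real (card V) / real k\<bar>
           \<le> sqrt (\<delta> / turan_density k r) * real (card V)"
proof (cases "V = {}")
  case False
  obtain q where q: "r = Suc q" "q \<ge> 1" using assms(4) by (cases r) auto
  obtain l where l: "k = Suc l" "q \<le> l" using assms(5) q by (cases k) auto
  let ?A = "{v\<in>V. c v = i}"
  have n: "real (card (V - ?A)) = real (card V) - real (card ?A)"
    using assms(1) by (subst card_Diff_subset) (auto simp: of_nat_diff card_mono)
  show ?thesis
    unfolding l(1)
  proof (rule near_max_part_size)
    show "(turan_density (Suc l) r - \<delta>) * real (card V) ^ r \<le> turan_density (Suc l) r * real (card V) ^ r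
        * (1 - (real (Suc l) * (real (card V) - real (card ?A)) / (real l * real (card V)) - 1)\<^sup>2)"
      using card_rainbow_le_class[of V c l i q] assms(1,2,3,7) q l False unfolding n by simp
  qed (use False assms(1,6) turan_density_pos[OF assms(5)] q l in \<open>auto simp: card_gt_0_iff\<close>)
qed simp

section \<open>Adjacent pairs inside the parts\<close>

definition inner_pairs :: "'a set \<Rightarrow> ('a \<Rightarrow> 'a \<Rightarrow> bool) \<Rightarrow> ('a \<Rightarrow> nat) \<Rightarrow> 'a set set" where
  "inner_pairs V E c = {\<beta>. \<beta> \<subseteq> V \<and> card \<beta> = 2 \<and> clique E \<beta> \<and> \<not> inj_on c \<beta>}"

lemma finite_inner_pairs: "finite V \<Longrightarrow> finite (inner_pairs V E c)"
  by (rule finite_subset[of _ "Pow V"]) (auto simp: inner_pairs_def)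

text \<open>
  If every rainbow $r$-subset of \<open>X\<close> were an edge, then \<open>X\<close> would be a clique with $k+1$ vertices.
\<close>
lemma missing_edge_in_transversal:
  assumes "clique_limited k r V E H" "2 \<le> r" "r \<le> k" "\<And>v. v \<in> V \<Longrightarrow> c v < k"
    and "X = {x, y} \<union> Y" "X \<subseteq> V" "x \<noteq> y" "E x y" "c x = c y"
    and "inj_on c Y" "c ` Y = {..<k} - {c x}"
  shows "card X = Suc k" "\<exists>m\<in>rainbow V c r - H. m \<subseteq> X"
proof -
  note D = clique_limitedD[OF assms(1)]
  have fX: "finite X" using assms(6) D(1) by (rule finite_subset)
  have xy: "x \<notin> Y" "y \<notin> Y" using assms(9,11) by auto
  have cx: "c x < k" using assms(4)[of x] assms(5,6) by auto
  have "card Y = k - 1" using card_image[OF assms(10)] assms(11) cx by simp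
  then show cX: "card X = Suc k" using xy assms(5,7) fX cx by simp
  have half: "inj_on c (insert z Y)" if "z \<in> {x, y}" for z
    using that assms(9-11) by auto
  show "\<exists>m\<in>rainbow V c r - H. m \<subseteq> X"
  proof (rule ccontr)
    assume "\<not> ?thesis"
    then have all: "e \<in> H" if "e \<in> rainbow V c r" "e \<subseteq> X" for e using that by blast
    \<comment> \<open>The sets \<open>insert x Y\<close> and \<open>insert y Y\<close> are rainbow
      with all k colours. As \<open>2 \<le> r \<le> k\<close>, any pair within one of them extends
      to a rainbow r-set there, hence to an edge. The pair x, y is the only one within neither, and
      it is adjacent by assumption.\<close>
    have ext: "\<exists>e\<in>H. p \<subseteq> e \<and> e \<subseteq> X" if z: "z \<in> {x, y}" and p: "p \<subseteq> insert z Y" "card p \<le> 2" for p z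
    proof -
      have "card (insert z Y) = k" using z xy \<open>card Y = k - 1\<close> cx fX assms(5) by auto
      then obtain e where e: "p \<subseteq> e" "e \<subseteq> insert z Y" "card e = r"
        using exists_subset_between[of p r "insert z Y"] p assms(2,3,5) fX by auto
      have "inj_on c e" using half[OF z] e(2) by (rule inj_on_subset)
      moreover have "e \<subseteq> X" using e(2) z assms(5) by auto
      ultimately have "e \<in> H" using e assms(6) by (intro all) (auto simp: rainbow_def)
      then show ?thesis using e \<open>e \<subseteq> X\<close> by blast
    qed
    have "clique E X"
      unfolding clique_def
    proof (intro ballI impI)
      fix u w assume uw: "u \<in> X" "w \<in> X" "u \<noteq> w"
      show "E u w"
      proof (cases "{u, w} = {x, y}")
        case True
        then show ?thesis using assms(8) D(2) by (auto simp: doubleton_eq_iff symp_def)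
      next
        case False
        then have "{u, w} \<subseteq> insert x Y \<or> {u, w} \<subseteq> insert y Y" using uw assms(5) by auto
        then obtain z where "z \<in> {x, y}" "{u, w} \<subseteq> insert z Y" by blast
        then obtain e where "e \<in> H" "{u, w} \<subseteq> e" using ext[of z "{u, w}"] uw(3) by auto
        then show ?thesis using D(5)[of e] uw(3) by (auto simp: clique_def)
      qed
    qed
    moreover obtain e where "e \<in> H" "e \<subseteq> X" using ext[of x "{}"] by auto
    ultimately have "card X \<le> k" using D(6) assms(6) by blast
    then show False using cX by simp
  qed
qed

text \<open>Double counting. An inner pair together with one vertex of each of the other k-1 colours
  forms a (k+1)-set that contains a missing rainbow edge. The pair is recovered as the only two
  vertices of equal colour, so the sets are distinct; each missing edge lies in at most n^(k+1-r) of
  them.\<close>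

lemma card_inner_pairs_le:
  assumes lim: "clique_limited k r V E H" and r: "2 \<le> r" "r \<le> k" and c: "\<And>v. v \<in> V \<Longrightarrow> c v < k"
    and m: "m \<ge> 0" "\<And>i. i < k \<Longrightarrow> m \<le> real (card {v\<in>V. c v = i})"
  shows "real (card (inner_pairs V E c)) * m ^ (k - 1)
           \<le> real (card (rainbow V c r - H)) * real (card V) ^ (Suc k - r)"
proof -
  note D = clique_limitedD[OF lim]
  let ?I = "inner_pairs V E c"
  define Z where "Z = (\<lambda>\<beta>. PiE ({..<k} - c ` \<beta>) (\<lambda>j. {v\<in>V. c v = j}))"
  define W where "W = (\<lambda>(\<beta>, z). \<beta> \<union> z ` ({..<k} - c ` \<beta>))"
  let ?X = "{X. X \<subseteq> V \<and> card X = Suc k \<and> (\<exists>m\<in>rainbow V c r - H. m \<subseteq> X)}"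
  have pair: "\<exists>x y. \<beta> = {x, y} \<and> x \<noteq> y \<and> c x = c y \<and> E x y \<and> x \<in> V \<and> y \<in> V" if "\<beta> \<in> ?I" for \<beta>
  proof -
    obtain x y where "\<beta> = {x, y}" "x \<noteq> y"
      using \<open>\<beta> \<in> ?I\<close> by (auto simp: inner_pairs_def card_2_iff)
    then show ?thesis using that by (auto simp: inner_pairs_def clique_def)
  qed
  have finZ: "finite (Z \<beta>)" for \<beta> unfolding Z_def using D(1) by (intro finite_PiE) auto
  have W_eq: "W (\<beta>, z) \<in> ?X" "\<beta> = {x\<in>W (\<beta>, z). \<exists>y\<in>W (\<beta>, z). y \<noteq> x \<and> c y = c x}"
    if \<beta>: "\<beta> \<in> ?I" and z: "z \<in> Z \<beta>" for \<beta> z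
  proof -
    obtain x y where xy: "\<beta> = {x, y}" "x \<noteq> y" "c x = c y" "E x y" "x \<in> V" "y \<in> V"
      using pair[OF \<beta>] by blast
    define Y where "Y = z ` ({..<k} - {c x})"
    have zc: "z j \<in> V \<and> c (z j) = j" if "j \<in> {..<k} - {c x}" for j
      using z that xy by (auto simp: Z_def PiE_def Pi_def)
    have WY: "W (\<beta>, z) = {x, y} \<union> Y" using xy by (simp add: W_def Y_def)
    have cY: "c ` Y = {..<k} - {c x}" using zc unfolding Y_def image_image by (auto simp: image_iff)
    have iY: "inj_on c Y" using zc unfolding Y_def by (auto simp: inj_on_def)
    have WV: "W (\<beta>, z) \<subseteq> V" using WY xy zc by (auto simp: Y_def)
    show "W (\<beta>, z) \<in> ?X"
      using missing_edge_in_transversal[OF lim r c WY WV xy(2,4,3) iY cY] WV by blast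
    show "\<beta> = {x\<in>W (\<beta>, z). \<exists>y\<in>W (\<beta>, z). y \<noteq> x \<and> c y = c x}"
    proof -
      have "\<And>u w. u \<in> Y \<Longrightarrow> w \<in> Y \<Longrightarrow> c u = c w \<Longrightarrow> u = w" using iY by (auto dest: inj_onD)
      moreover have "\<And>u. u \<in> Y \<Longrightarrow> c u \<noteq> c x" using cY by auto
      ultimately show ?thesis unfolding WY using xy(1-3) by auto metis+
    qed
  qed
  have inj: "inj_on W (Sigma ?I Z)"
  proof (rule inj_onI, clarify)
    fix \<beta> z \<beta>' z'
    assume a: "\<beta> \<in> ?I" "z \<in> Z \<beta>" "\<beta>' \<in> ?I" "z' \<in> Z \<beta>'" and eq: "W (\<beta>, z) = W (\<beta>', z')"
    have \<beta>: "\<beta> = \<beta>'" using W_eq(2)[OF a(1,2)] W_eq(2)[OF a(3,4)] eq by simp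
    let ?J = "{..<k} - c ` \<beta>"
    have "z j = z' j" if j: "j \<in> ?J" for j
    proof -
      have "z j \<in> W (\<beta>, z)" using j by (auto simp: W_def)
      then have "z j \<in> \<beta> \<union> z' ` ?J" unfolding eq using \<beta> by (simp add: W_def)
      moreover have cz: "c (z j) = j" using a(2) j by (auto simp: Z_def PiE_def Pi_def)
      ultimately obtain j' where j': "j' \<in> ?J" "z j = z' j'"
        using j by (metis DiffD2 UnE imageE imageI)
      have "c (z' j') = j'" using a(4) j'(1) unfolding \<beta> by (auto simp: Z_def PiE_def Pi_def)
      then show ?thesis using j'(2) cz by simp
    qed
    then have "z = z'" using a(2,4) \<beta> unfolding Z_def by (intro PiE_ext[of z ?J _ z']) auto
    then show "\<beta> = \<beta>' \<and> z = z'" using \<beta> by simp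
  qed
  have "real (card ?I) * m ^ (k - 1) = (\<Sum>\<beta>\<in>?I. m ^ (k - 1))" by simp
  also have "\<dots> \<le> (\<Sum>\<beta>\<in>?I. real (card (Z \<beta>)))"
  proof (rule sum_mono)
    fix \<beta> assume "\<beta> \<in> ?I"
    then obtain x where x: "c ` \<beta> = {c x}" "c x < k" using pair[of \<beta>] c by auto
    have "m ^ (k - 1) = (\<Prod>j\<in>{..<k} - {c x}. m)" using x(2) by simp
    also have "\<dots> \<le> (\<Prod>j\<in>{..<k} - {c x}. real (card {v\<in>V. c v = j}))"
      using m by (intro prod_mono) auto
    also have "\<dots> = real (card (Z \<beta>))" unfolding Z_def x(1) by (simp add: card_PiE)
    finally show "m ^ (k - 1) \<le> real (card (Z \<beta>))" .
  qed
  also have "\<dots> = real (card (Sigma ?I Z))"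
    using finite_inner_pairs[OF D(1)] finZ by (simp add: card_SigmaI)
  also have "card (Sigma ?I Z) = card (W ` Sigma ?I Z)" using card_image[OF inj] by simp
  also have "real (card (W ` Sigma ?I Z)) \<le> real (card ?X)"
    using W_eq(1) D(1) by (intro of_nat_mono card_mono) auto
  also have "\<dots> \<le> real (card (rainbow V c r - H) * card V ^ (Suc k - r))"
    using D(1) by (intro of_nat_mono card_supersets_le) (auto simp: finite_rainbow, auto simp: rainbow_def)
  finally show ?thesis by simp
qed

subsection \<open>Stability for the number of edges\<close>

text \<open>At least (D - 2\<delta>) n^r edges are rainbow, while there are at most D n^r rainbow
  sets altogether. Hence the classes are nearly equal and at most 2\<delta> n^r rainbow sets are
  missing, so \<open>card_inner_pairs_le\<close> applies with linear class sizes.\<close>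

lemma few_inner_pairs:
  fixes \<epsilon> :: real
  assumes r: "2 \<le> r" "r \<le> k" and "\<epsilon> > 0"
  obtains \<delta> :: real where "\<delta> > 0"
    "\<And>(V::'a set) E H c. clique_limited k r V E H \<Longrightarrow> \<forall>v\<in>V. c v < k \<Longrightarrow>
      (turan_density k r - \<delta>) * real (card V) ^ r \<le> real (card H) \<Longrightarrow>
      real (card {e\<in>H. \<not> inj_on c e}) \<le> \<delta> * real (card V) ^ r \<Longrightarrow>
      (\<forall>i<k. \<bar>real (card {v\<in>V. c v = i}) - real (card V) / real k\<bar> \<le> \<epsilon> * real (card V)) \<and>
      real (card (inner_pairs V E c)) \<le> \<epsilon> * real (card V) ^ 2"
proof -
  define D where "D = turan_density k r"
  have D: "D > 0" using turan_density_pos[OF r(2)] by (simp add: D_def)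
  have k: "real k > 0" using r by simp
  \<comment> \<open>The bound 1/(2k) guarantees at least n/(2k) vertices in every class.\<close>
  define \<eta> where "\<eta> = min \<epsilon> (1 / (2 * real k))"
  have \<eta>: "\<eta> > 0" "\<eta> \<le> \<epsilon>" "\<eta> \<le> 1 / (2 * real k)" using assms k by (auto simp: \<eta>_def)
  \<comment> \<open>The first bound gives sqrt(2\<delta>/D) \<le> \<eta>; the second offsets the
    factor (2k)^(k-1) lost when class sizes are bounded below by n/(2k).\<close>
  define \<delta> where "\<delta> = min (D * \<eta>\<^sup>2 / 2) (\<epsilon> / (2 * (2 * real k) ^ (k - 1)))"
  have \<delta>: "\<delta> > 0" "\<delta> \<le> D * \<eta>\<^sup>2 / 2" "2 * \<delta> * (2 * real k) ^ (k - 1) \<le> \<epsilon>"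
  proof -
    show "\<delta> > 0" "\<delta> \<le> D * \<eta>\<^sup>2 / 2" using D \<eta> assms k by (auto simp: \<delta>_def)
    have "\<delta> \<le> \<epsilon> / (2 * (2 * real k) ^ (k - 1))" by (simp add: \<delta>_def)
    moreover have "2 * (2 * real k) ^ (k - 1) > 0" using k by simp
    ultimately show "2 * \<delta> * (2 * real k) ^ (k - 1) \<le> \<epsilon>"
      by (simp add: pos_le_divide_eq mult.commute mult.left_commute)
  qed
  show ?thesis
  proof (rule that[OF \<delta>(1)])
    fix V :: "'a set" and E H c
    assume lim: "clique_limited k r V E H" and c: "\<forall>v\<in>V. c v < k"
      and H: "(turan_density k r - \<delta>) * real (card V) ^ r \<le> real (card H)"
      and bad: "real (card {e\<in>H. \<not> inj_on c e}) \<le> \<delta> * real (card V) ^ r"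
    note L = clique_limitedD[OF lim]
    let ?n = "real (card V)"
    let ?R = "rainbow V c r"
    have fR: "finite ?R" using L(1) by (rule finite_rainbow)
    have "card H = card {e\<in>H. \<not> inj_on c e} + card (?R \<inter> H)"
    proof -
      have "H = {e\<in>H. \<not> inj_on c e} \<union> (?R \<inter> H)" using L(3,4) by (auto simp: rainbow_def)
      moreover have "{e\<in>H. \<not> inj_on c e} \<inter> (?R \<inter> H) = {}" by (auto simp: rainbow_def)
      ultimately show ?thesis using clique_limited_finite(1)[OF lim]
        by (metis card_Un_disjoint finite_Un)
    qed
    then have RH: "real (card (?R \<inter> H)) \<ge> (D - 2 * \<delta>) * ?n ^ r"
      using H bad by (simp add: D_def algebra_simps)
    have R_split: "card ?R = card (?R - H) + card (?R \<inter> H)"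
      using card_Int_Diff[OF fR, of H] by simp
    have "clique_limited k r V (\<lambda>x y. c x \<noteq> c y) ?R"
      by (rule clique_limited_rainbow[of V c "{..<k}"]) (use L(1) c in auto)
    then have "real (card ?R) \<le> D * ?n ^ r" unfolding D_def by (rule card_clique_limited_le)
    then have miss: "real (card (?R - H)) \<le> 2 * \<delta> * ?n ^ r"
      using RH R_split by (simp add: algebra_simps)
    have "real (card ?R) \<ge> (turan_density k r - 2 * \<delta>) * ?n ^ r"
      using RH R_split by (simp add: D_def)
    then have sz: "\<bar>real (card {v\<in>V. c v = i}) - ?n / real k\<bar> \<le> sqrt (2 * \<delta> / D) * ?n" if "i < k" for i
      unfolding D_def using rainbow_class_size[OF L(1) _ that r, of c "2 * \<delta>"] c \<delta>(1) by auto
    have "sqrt (2 * \<delta> / D) \<le> sqrt (\<eta>\<^sup>2)"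
      using \<delta>(2) D by (intro real_sqrt_le_mono) (simp add: field_simps)
    then have "sqrt (2 * \<delta> / D) * ?n \<le> \<eta> * ?n" using \<eta>(1) by (intro mult_right_mono) auto
    then have sz: "\<bar>real (card {v\<in>V. c v = i}) - ?n / real k\<bar> \<le> \<eta> * ?n" if "i < k" for i
      using sz[OF that] by linarith
    have "\<eta> * ?n \<le> \<epsilon> * ?n" using \<eta>(2) by (intro mult_right_mono) auto
    then have sz': "\<forall>i<k. \<bar>real (card {v\<in>V. c v = i}) - ?n / real k\<bar> \<le> \<epsilon> * ?n"
      using sz by force
    have "\<eta> * ?n \<le> 1 / (2 * real k) * ?n" using \<eta>(3) by (intro mult_right_mono) auto
    then have low: "?n / (2 * real k) \<le> real (card {v\<in>V. c v = i})" if "i < k" for i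
      using sz[OF that] k by (simp add: abs_le_iff field_simps)
    have inner: "real (card (inner_pairs V E c)) \<le> \<epsilon> * ?n ^ 2"
    proof (cases "V = {}")
      case True
      then have "inner_pairs V E c = {}" by (auto simp: inner_pairs_def)
      then show ?thesis using assms(3) by simp
    next
      case False
      then have n: "?n > 0" using L(1) by (simp add: card_gt_0_iff)
      have "real (card (inner_pairs V E c)) * (?n / (2 * real k)) ^ (k - 1)
          \<le> real (card (?R - H)) * ?n ^ (Suc k - r)"
        by (rule card_inner_pairs_le[OF lim r]) (use c low in auto)
      also have "\<dots> \<le> (2 * \<delta> * ?n ^ r) * ?n ^ (Suc k - r)"
        using miss by (intro mult_right_mono) auto
      also have "\<dots> = 2 * \<delta> * ?n ^ (r + (Suc k - r))" by (simp only: power_add mult.assoc)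
      also have "r + (Suc k - r) = 2 + (k - 1)" using r by simp
      also have "2 * \<delta> * ?n ^ (2 + (k - 1)) = (2 * \<delta> * (2 * real k) ^ (k - 1)) * ?n ^ 2 * (?n / (2 * real k)) ^ (k - 1)"
        unfolding power_add power_divide using k by simp
      also have "\<dots> \<le> \<epsilon> * ?n ^ 2 * (?n / (2 * real k)) ^ (k - 1)"
        using \<delta>(3) n k by (intro mult_right_mono) auto
      finally show ?thesis using n k by (simp add: mult_le_cancel_right)
    qed
    show "(\<forall>i<k. \<bar>real (card {v\<in>V. c v = i}) - ?n / real k\<bar> \<le> \<epsilon> * ?n) \<and>
      real (card (inner_pairs V E c)) \<le> \<epsilon> * ?n ^ 2"
      using sz' inner by blast
  qed
qed

text \<open>The link term and the inner term of the pivot inequality each obey their own extremal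
  bound, and these bounds add up to at most D n^(r+1). So the surplus is at most \<delta> n^(r+1),
  and neither term falls short of its bound by more than that.\<close>

lemma near_max_pivot:
  fixes \<delta> :: real
  assumes lim: "clique_limited (Suc k) (Suc r) V E H" and r: "1 \<le> r" "r \<le> k" and ne: "V \<noteq> {}"
    and \<delta>: "0 \<le> \<delta>" "\<delta> \<le> turan_density (Suc k) (Suc r) / (2 * real (Suc k))\<^sup>2"
    and H: "(turan_density (Suc k) (Suc r) - \<delta>) * real (card V) ^ Suc r \<le> real (card H)"
  obtains v where "v \<in> V"
    "real (card {e\<in>H. card (e - nbrs V E v) \<ge> 2}) \<le> \<delta> * real (card V) ^ Suc r"
    "(turan_density k r - 2 * real (Suc k) * 4 ^ Suc r * \<delta>) * real (card (nbrs V E v)) ^ r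
       \<le> real (card (link v H))"
    "(turan_density k (Suc r) - 2 * real (Suc k) * 4 ^ Suc r * \<delta>) * real (card (nbrs V E v)) ^ Suc r
       \<le> real (card {e\<in>H. e \<subseteq> nbrs V E v})"
proof -
  note L = clique_limitedD[OF lim]
  obtain v where v: "v \<in> V" and piv:
    "weight (\<lambda>_. 1) H + weight (\<lambda>_. 1) {e\<in>H. card (e - nbrs V E v) \<ge> 2}
      \<le> sum (\<lambda>_. 1) (V - nbrs V E v) * weight (\<lambda>_. 1) (link v H)
        + weight (\<lambda>_. 1) {e\<in>H. e \<subseteq> nbrs V E v}"
    using max_link_pivot[OF lim ne, of "\<lambda>_. 1"] by auto
  define B where "B = nbrs V E v"
  define n a b where "n = real (card V)" and "a = real (card (V - B))" and "b = real (card B)"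
  define D D1 D2 where "D = turan_density (Suc k) (Suc r)" and "D1 = turan_density k r"
    and "D2 = turan_density k (Suc r)"
  define X h g where "X = real (card {e\<in>H. card (e - B) \<ge> 2})" and "h = real (card (link v H))"
    and "g = real (card {e\<in>H. e \<subseteq> B})"
  have D: "D > 0" using r by (simp add: D_def turan_density_pos)
  have BV: "B \<subseteq> V" by (auto simp: B_def nbrs_def)
  have n: "n > 0" using ne L(1) by (simp add: n_def card_gt_0_iff)
  have ab: "a = n - b"
    using card_Diff_subset[OF finite_subset[OF BV L(1)] BV] card_mono[OF L(1) BV]
    by (simp add: a_def b_def n_def of_nat_diff)
  have nn: "a \<ge> 0" "b \<ge> 0" "X \<ge> 0" "g \<ge> 0" "h \<ge> 0" by (auto simp: a_def b_def X_def g_def h_def)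
  have piv: "real (card H) + X \<le> a * h + g"
    using piv by (simp add: weight_const_1 X_def a_def h_def g_def B_def)
  have h: "h \<le> D1 * b ^ r" and g: "g \<le> D2 * b ^ Suc r"
    unfolding h_def g_def D1_def D2_def b_def B_def
    using card_clique_limited_le[OF clique_limited_link[OF lim v]]
      card_clique_limited_le[OF clique_limited_nbrs[OF lim v]] by auto
  have ah: "a * h \<le> a * (D1 * b ^ r)" using h nn by (intro mult_left_mono)
  let ?S = "1 - (real (Suc k) * b / (real k * n) - 1)\<^sup>2"
  have step: "a * (D1 * b ^ r) + D2 * b ^ Suc r \<le> D * n ^ Suc r * ?S"
    using turan_step_bound[of a b r k] nn n r unfolding D1_def D2_def D_def ab by simp
  also have "\<dots> \<le> D * n ^ Suc r * 1" using D n by (intro mult_left_mono) auto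
  finally have step1: "a * (D1 * b ^ r) + D2 * b ^ Suc r \<le> D * n ^ Suc r" by simp
  have H': "(D - \<delta>) * n ^ Suc r \<le> real (card H)" using H by (simp add: D_def n_def)
  have X: "X \<le> \<delta> * n ^ Suc r"
    using piv ah g step1 H' by (simp add: algebra_simps)
  have "\<bar>a - n / real (Suc k)\<bar> \<le> sqrt (\<delta> / D) * n"
  proof (rule near_max_part_size[where m = "n ^ Suc r"])
    show "(D - \<delta>) * n ^ Suc r \<le> D * n ^ Suc r * (1 - (real (Suc k) * (n - a) / (real k * n) - 1)\<^sup>2)"
      using piv ah g step H' nn(3) unfolding ab by simp
  qed (use n D \<delta> r in auto)
  \<comment> \<open>The smallness of \<delta> makes the deviation of |A| at most half of
    n/(k+1).\<close>
  also have "sqrt (\<delta> / D) \<le> sqrt ((1 / (2 * real (Suc k)))\<^sup>2)"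
    using \<delta>(2) D by (intro real_sqrt_le_mono)
      (simp add: D_def[symmetric] pos_divide_le_eq power_divide mult.commute)
  also have "\<dots> = 1 / (2 * real (Suc k))" by simp
  finally have aa: "\<bar>a - n / real (Suc k)\<bar> \<le> n / real (Suc k) / 2" using n by (simp add: mult.commute)
  define \<alpha> where "\<alpha> = n / real (Suc k)"
  have \<alpha>: "n = real (Suc k) * \<alpha>" "\<alpha> \<le> n / 2" "\<bar>a - \<alpha>\<bar> \<le> \<alpha> / 2"
  proof -
    show "n = real (Suc k) * \<alpha>" by (simp add: \<alpha>_def)
    show "\<alpha> \<le> n / 2" unfolding \<alpha>_def using n r by (intro divide_left_mono) auto
    show "\<bar>a - \<alpha>\<bar> \<le> \<alpha> / 2" using aa by (simp add: \<alpha>_def)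
  qed
  have a_low: "n \<le> 2 * real (Suc k) * a"
  proof -
    have "\<alpha> \<le> 2 * a" using \<alpha>(3) by linarith
    then have "real (Suc k) * \<alpha> \<le> real (Suc k) * (2 * a)" by (intro mult_left_mono) auto
    also have "\<dots> = 2 * real (Suc k) * a" by simp
    finally show ?thesis using \<alpha>(1) by simp
  qed
  \<comment> \<open>Since k \<ge> 1, a \<le> 3\<alpha>/2 \<le> 3n/4.\<close>
  have b_low: "n \<le> 4 * b" using \<alpha>(2,3) ab by linarith
  have npow: "n ^ m \<le> 4 ^ m * b ^ m" for m
    using power_mono[OF b_low, of m] n by (simp add: power_mult_distrib)
  \<comment> \<open>By \<open>a_low\<close> and \<open>b_low\<close> the error n^(r+1) is at most a
    constant times a b^r, and also at most a constant times b^(r+1); \<open>K\<close> majorises both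
    constants.\<close>
  define K where "K = 2 * real (Suc k) * 4 ^ Suc r"
  have c1: "(D1 - K * \<delta>) * b ^ r \<le> h"
  proof -
    have "a * (D1 * b ^ r) - \<delta> * n ^ Suc r \<le> a * h" using piv g step1 H' nn by (simp add: algebra_simps)
    moreover have "\<delta> * n ^ Suc r \<le> a * (K * \<delta> * b ^ r)"
    proof -
      have "n ^ Suc r = n * n ^ r" by simp
      also have "\<dots> \<le> (2 * real (Suc k) * a) * (4 ^ r * b ^ r)"
        using a_low npow n nn by (intro mult_mono) auto
      also have "\<dots> \<le> (2 * real (Suc k) * a) * (4 ^ Suc r * b ^ r)"
        using nn by (intro mult_left_mono mult_right_mono) auto
      finally have "\<delta> * n ^ Suc r \<le> \<delta> * ((2 * real (Suc k) * a) * (4 ^ Suc r * b ^ r))"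
        using \<delta>(1) by (intro mult_left_mono)
      then show ?thesis by (simp add: K_def mult_ac)
    qed
    ultimately have "a * ((D1 - K * \<delta>) * b ^ r) \<le> a * h" by (simp add: algebra_simps)
    moreover have "a > 0" using a_low n by (smt (verit) mult_nonneg_nonpos of_nat_0_le_iff)
    ultimately show ?thesis by simp
  qed
  have c2: "(D2 - K * \<delta>) * b ^ Suc r \<le> g"
  proof -
    have "D2 * b ^ Suc r - \<delta> * n ^ Suc r \<le> g" using piv ah step1 H' nn by (simp add: algebra_simps)
    moreover have "\<delta> * n ^ Suc r \<le> K * \<delta> * b ^ Suc r"
    proof -
      have "n ^ Suc r \<le> 1 * (4 ^ Suc r * b ^ Suc r)" using npow[of "Suc r"] by simp
      also have "\<dots> \<le> (2 * real (Suc k)) * (4 ^ Suc r * b ^ Suc r)"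
        using nn by (intro mult_right_mono) auto
      finally have "\<delta> * n ^ Suc r \<le> \<delta> * ((2 * real (Suc k)) * (4 ^ Suc r * b ^ Suc r))"
        using \<delta>(1) by (intro mult_left_mono)
      then show ?thesis by (simp add: K_def mult_ac)
    qed
    ultimately show ?thesis by (simp add: algebra_simps)
  qed
  show ?thesis
    using that[OF v] X c1 c2 unfolding X_def n_def D1_def D2_def b_def h_def g_def K_def B_def by simp
qed

section \<open>Stability by induction on the uniformity\<close>

lemma card_le_add_of_subset_Un:
  "finite A \<Longrightarrow> finite B \<Longrightarrow> S \<subseteq> A \<union> B \<Longrightarrow> card S \<le> card A + card B"
  by (meson card_Un_le card_mono finite_UnI le_trans)

text \<open>The colour k given to the vertices outside \<open>B\<close> is not a value of
  \<open>c\<close>, so a repeated colour occurs wholly outside or wholly inside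
  \<open>B\<close>.\<close>

lemma not_inj_extend:
  fixes c :: "'a \<Rightarrow> nat"
  assumes "\<not> inj_on (\<lambda>v. if v \<in> B then c v else k) e" "\<And>v. c v < k" "finite e"
  shows "card (e - B) \<ge> 2 \<or> \<not> inj_on c (e \<inter> B)"
proof (rule ccontr)
  assume n: "\<not> ?thesis"
  obtain x y where xy: "x \<in> e" "y \<in> e" "x \<noteq> y" "(if x \<in> B then c x else k) = (if y \<in> B then c y else k)"
    using assms(1) by (auto simp: inj_on_def)
  have "x \<in> B \<longleftrightarrow> y \<in> B" using xy(4) assms(2) by (metis nat_neq_iff)
  moreover have False if "x \<in> B" "y \<in> B" using n xy that by (auto simp: inj_on_def)
  moreover have False if "x \<notin> B" "y \<notin> B"
  proof -
    have "card {x, y} \<le> card (e - B)" using that xy assms(3) by (intro card_mono) auto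
    then show False using n xy(3) by simp
  qed
  ultimately show False by blast
qed

text \<open>The \<open>itself\<close> argument fixes the vertex type, which the numbers do not
  mention. Only non-rainbow edges are controlled here; missing edges and part sizes follow
  afterwards by counting.\<close>

definition turan_stable :: "'a itself \<Rightarrow> nat \<Rightarrow> nat \<Rightarrow> bool" where
  "turan_stable T k r \<longleftrightarrow> (\<forall>\<epsilon>::real. \<epsilon> > 0 \<longrightarrow> (\<exists>\<delta>>0. \<forall>(V::'a set) E H. clique_limited k r V E H \<longrightarrow>
    (turan_density k r - \<delta>) * real (card V) ^ r \<le> real (card H) \<longrightarrow>
    (\<exists>c. (\<forall>v. c v < k) \<and> real (card {e\<in>H. \<not> inj_on c e}) \<le> \<epsilon> * real (card V) ^ r)))"

lemma turan_stableE:
  assumes "turan_stable TYPE('a) k r" "\<epsilon> > 0"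
  obtains \<delta> :: real where "\<delta> > 0"
    "\<And>(V::'a set) E H. clique_limited k r V E H \<Longrightarrow>
      (turan_density k r - \<delta>) * real (card V) ^ r \<le> real (card H) \<Longrightarrow>
      (\<exists>c. (\<forall>v. c v < k) \<and> real (card {e\<in>H. \<not> inj_on c e}) \<le> \<epsilon> * real (card V) ^ r)"
proof -
  from assms(1)[unfolded turan_stable_def, rule_format, OF assms(2)] show ?thesis
    by (elim exE conjE) (rule that, assumption, simp)
qed

text \<open>The link of a vertex in a graph is a set of single vertices and determines no partition.
  The induction therefore runs on k, and the partition of the neighbourhood comes from the edges
  inside it.\<close>

lemma turan_stable_2: "turan_stable TYPE('a) (Suc k) 2"
proof (induction k)
  case 0
  show ?case
    unfolding turan_stable_def
  proof (intro allI impI exI[of _ "1::real"] conjI)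
    fix \<epsilon> :: real and V :: "'a set" and E H
    assume "\<epsilon> > 0" "clique_limited (Suc 0) 2 V E H"
    then have "H = {}" using clique_limited_empty by fastforce
    then show "\<exists>c. (\<forall>v. c v < Suc 0) \<and> real (card {e\<in>H. \<not> inj_on c e}) \<le> \<epsilon> * real (card V) ^ 2"
      using \<open>\<epsilon> > 0\<close> by (intro exI[of _ "\<lambda>_. 0"]) simp
  qed simp
next
  case (Suc l)
  define k where "k = Suc l"
  show ?case
    unfolding turan_stable_def k_def[symmetric]
  proof (intro allI impI)
    fix \<epsilon> :: real assume \<epsilon>: "\<epsilon> > 0"
    obtain \<delta>0 where \<delta>0: "\<delta>0 > 0" and IH: "\<And>(V::'a set) E H. clique_limited k 2 V E H \<Longrightarrow>
      (turan_density k 2 - \<delta>0) * real (card V) ^ 2 \<le> real (card H) \<Longrightarrow>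
      (\<exists>c. (\<forall>v. c v < k) \<and> real (card {e\<in>H. \<not> inj_on c e}) \<le> \<epsilon> / 2 * real (card V) ^ 2)"
      by (rule turan_stableE[OF Suc[folded k_def] half_gt_zero[OF \<epsilon>]]) (rule that)
    define K where "K = 2 * real (Suc k) * 4 ^ 2"
    \<comment> \<open>The three bounds serve the pivot lemma, the edges with two vertices outside
      \<open>B\<close>, and the induction hypothesis on \<open>B\<close>.\<close>
    define \<delta> where "\<delta> = min (turan_density (Suc k) 2 / (2 * real (Suc k))\<^sup>2) (min (\<epsilon> / 2) (\<delta>0 / K))"
    have K: "K > 0" by (simp add: K_def)
    have D: "turan_density (Suc k) 2 > 0" by (simp add: turan_density_pos k_def)
    have \<delta>: "\<delta> > 0" "\<delta> \<le> turan_density (Suc k) 2 / (2 * real (Suc k))\<^sup>2" "\<delta> \<le> \<epsilon> / 2" "K * \<delta> \<le> \<delta>0"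
    proof -
      show "\<delta> > 0" using D \<epsilon> \<delta>0 K by (simp add: \<delta>_def)
      show "\<delta> \<le> turan_density (Suc k) 2 / (2 * real (Suc k))\<^sup>2" "\<delta> \<le> \<epsilon> / 2" unfolding \<delta>_def by (simp_all only: min_le_iff_disj order_refl simp_thms)
      have "\<delta> \<le> \<delta>0 / K" unfolding \<delta>_def by (simp_all only: min_le_iff_disj order_refl simp_thms)
      then show "K * \<delta> \<le> \<delta>0" using K by (simp add: pos_le_divide_eq mult.commute)
    qed
    show "\<exists>\<delta>>0. \<forall>(V::'a set) E H. clique_limited (Suc k) 2 V E H \<longrightarrow>
      (turan_density (Suc k) 2 - \<delta>) * real (card V) ^ 2 \<le> real (card H) \<longrightarrow>
      (\<exists>c. (\<forall>v. c v < Suc k) \<and> real (card {e\<in>H. \<not> inj_on c e}) \<le> \<epsilon> * real (card V) ^ 2)"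
    proof (intro exI[of _ \<delta>] conjI \<delta>(1), (intro allI impI))
      fix V :: "'a set" and E H
      assume lim: "clique_limited (Suc k) 2 V E H"
        and H: "(turan_density (Suc k) 2 - \<delta>) * real (card V) ^ 2 \<le> real (card H)"
      note L = clique_limitedD[OF lim]
      show "\<exists>c. (\<forall>v. c v < Suc k) \<and> real (card {e\<in>H. \<not> inj_on c e}) \<le> \<epsilon> * real (card V) ^ 2"
      proof (cases "V = {}")
        case True
        then have "H = {}" using L(3,4) by fastforce
        then show ?thesis using \<epsilon> by (intro exI[of _ "\<lambda>_. 0"]) simp
      next
        case False
        obtain v where v: "v \<in> V"
          and X: "real (card {e\<in>H. card (e - nbrs V E v) \<ge> 2}) \<le> \<delta> * real (card V) ^ 2"
          and g: "(turan_density k 2 - K * \<delta>) * real (card (nbrs V E v)) ^ 2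
             \<le> real (card {e\<in>H. e \<subseteq> nbrs V E v})"
          using near_max_pivot[of k 1 V E H \<delta>] lim False \<delta> H
          unfolding K_def by (auto simp: k_def numeral_2_eq_2)
        define B where "B = nbrs V E v"
        have BV: "B \<subseteq> V" by (auto simp: B_def nbrs_def)
        have "(turan_density k 2 - \<delta>0) * real (card B) ^ 2 \<le> (turan_density k 2 - K * \<delta>) * real (card B) ^ 2"
          using \<delta>(4) by (intro mult_right_mono) auto
        also have "\<dots> \<le> real (card {e\<in>H. e \<subseteq> B})" using g by (simp add: B_def)
        finally obtain c where c: "\<And>v. c v < k"
          and cb: "real (card {e\<in>{e\<in>H. e \<subseteq> B}. \<not> inj_on c e}) \<le> \<epsilon> / 2 * real (card B) ^ 2"
          using IH[OF clique_limited_nbrs[OF lim v, folded B_def]] by blast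
        define c' where "c' = (\<lambda>v. if v \<in> B then c v else k)"
        have "{e\<in>H. \<not> inj_on c' e} \<subseteq> {e\<in>H. card (e - B) \<ge> 2} \<union> {e\<in>{e\<in>H. e \<subseteq> B}. \<not> inj_on c e}"
        proof
          fix e assume "e \<in> {e\<in>H. \<not> inj_on c' e}"
          then have e: "e \<in> H" "\<not> inj_on c' e" by auto
          have fe: "finite e" using clique_limited_finite(2)[OF lim e(1)] .
          have "card (e - B) \<ge> 2 \<or> \<not> inj_on c (e \<inter> B)"
            using not_inj_extend[where c = c, OF _ c fe] e(2) unfolding c'_def by blast
          \<comment> \<open>Special to graphs: both vertices of the edge are needed for a repeated
            colour, so the edge lies inside \<open>B\<close>.\<close>
          moreover have "e \<subseteq> B" if n: "\<not> inj_on c (e \<inter> B)"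
          proof -
            have "card (e \<inter> B) \<ge> 2"
            proof (rule ccontr)
              assume "\<not> card (e \<inter> B) \<ge> 2"
              then have "card (e \<inter> B) = 0 \<or> card (e \<inter> B) = 1" by linarith
              then show False using n fe by (auto simp: card_1_singleton_iff)
            qed
            then have "e \<inter> B = e" using L(4)[OF e(1)] fe by (intro card_seteq) auto
            then show ?thesis by blast
          qed
          ultimately show "e \<in> {e\<in>H. card (e - B) \<ge> 2} \<union> {e\<in>{e\<in>H. e \<subseteq> B}. \<not> inj_on c e}"
            using e(1) by (auto simp: Int_absorb2)
        qed
        then have "card {e\<in>H. \<not> inj_on c' e}
            \<le> card {e\<in>H. card (e - B) \<ge> 2} + card {e\<in>{e\<in>H. e \<subseteq> B}. \<not> inj_on c e}"
          using clique_limited_finite(1)[OF lim] by (intro card_le_add_of_subset_Un) auto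
        then have "real (card {e\<in>H. \<not> inj_on c' e}) \<le> \<delta> * real (card V) ^ 2 + \<epsilon> / 2 * real (card B) ^ 2"
          using X cb by (simp add: B_def)
        also have "\<dots> \<le> \<epsilon> / 2 * real (card V) ^ 2 + \<epsilon> / 2 * real (card V) ^ 2"
          using \<delta>(3) \<epsilon> card_mono[OF L(1) BV] by (intro add_mono mult_mono power_mono) auto
        finally have "real (card {e\<in>H. \<not> inj_on c' e}) \<le> \<epsilon> * real (card V) ^ 2" by simp
        moreover have "c' v < Suc k" for v using c[of v] by (simp add: c'_def)
        ultimately show ?thesis by blast
      qed
    qed
  qed
qed

text \<open>
  A partition of the neighbourhood \<open>B\<close> of \<open>v\<close> adapted to the link of \<open>v\<close> alone is good for all
  edges: by \<open>few_inner_pairs\<close> it has few pairs of the graph \<open>E\<close> inside its parts, whichever edges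
  these pairs come from.
\<close>
lemma turan_stable_Suc:
  assumes st: "turan_stable TYPE('a) k r" and r: "2 \<le> r" "r \<le> k"
  shows "turan_stable TYPE('a) (Suc k) (Suc r)"
  unfolding turan_stable_def
proof (intro allI impI)
  fix \<epsilon> :: real assume \<epsilon>: "\<epsilon> > 0"
  obtain \<delta>1 where \<delta>1: "\<delta>1 > 0" and inner: "\<And>(V::'a set) E H c. clique_limited k r V E H \<Longrightarrow> (\<forall>v\<in>V. c v < k) \<Longrightarrow>
    (turan_density k r - \<delta>1) * real (card V) ^ r \<le> real (card H) \<Longrightarrow>
    real (card {e\<in>H. \<not> inj_on c e}) \<le> \<delta>1 * real (card V) ^ r \<Longrightarrow>
    (\<forall>i<k. \<bar>real (card {v\<in>V. c v = i}) - real (card V) / real k\<bar> \<le> \<epsilon> / 2 * real (card V)) \<and>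
    real (card (inner_pairs V E c)) \<le> \<epsilon> / 2 * real (card V) ^ 2"
    by (rule few_inner_pairs[OF r half_gt_zero[OF \<epsilon>]]) (rule that)
  \<comment> \<open>The induction hypothesis is applied with tolerance \<delta>1, the number of bad
    link edges that \<open>few_inner_pairs\<close> allows.\<close>
  obtain \<delta>0 where \<delta>0: "\<delta>0 > 0" and IH: "\<And>(V::'a set) E H. clique_limited k r V E H \<Longrightarrow>
    (turan_density k r - \<delta>0) * real (card V) ^ r \<le> real (card H) \<Longrightarrow>
    (\<exists>c. (\<forall>v. c v < k) \<and> real (card {e\<in>H. \<not> inj_on c e}) \<le> \<delta>1 * real (card V) ^ r)"
    by (rule turan_stableE[OF st \<delta>1]) (rule that)
  define K where "K = 2 * real (Suc k) * 4 ^ Suc r"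
  define D where "D = turan_density (Suc k) (Suc r)"
  define \<delta> where "\<delta> = min (D / (2 * real (Suc k))\<^sup>2) (min (\<epsilon> / 2) (min (\<delta>0 / K) (\<delta>1 / K)))"
  have K: "K > 0" by (simp add: K_def)
  have D: "D > 0" using r by (simp add: turan_density_pos D_def)
  have \<delta>: "\<delta> > 0" "\<delta> \<le> D / (2 * real (Suc k))\<^sup>2" "\<delta> \<le> \<epsilon> / 2" "K * \<delta> \<le> \<delta>0" "K * \<delta> \<le> \<delta>1"
  proof -
    show "\<delta> > 0" using D \<epsilon> \<delta>0 \<delta>1 K by (simp add: \<delta>_def)
    show "\<delta> \<le> D / (2 * real (Suc k))\<^sup>2" "\<delta> \<le> \<epsilon> / 2" unfolding \<delta>_def by (simp_all only: min_le_iff_disj order_refl simp_thms)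
    have "\<delta> \<le> \<delta>0 / K" "\<delta> \<le> \<delta>1 / K" unfolding \<delta>_def by (simp_all only: min_le_iff_disj order_refl simp_thms)
    then show "K * \<delta> \<le> \<delta>0" "K * \<delta> \<le> \<delta>1" using K by (auto simp: pos_le_divide_eq mult.commute)
  qed
  show "\<exists>\<delta>>0. \<forall>(V::'a set) E H. clique_limited (Suc k) (Suc r) V E H \<longrightarrow>
    (turan_density (Suc k) (Suc r) - \<delta>) * real (card V) ^ Suc r \<le> real (card H) \<longrightarrow>
    (\<exists>c. (\<forall>v. c v < Suc k) \<and> real (card {e\<in>H. \<not> inj_on c e}) \<le> \<epsilon> * real (card V) ^ Suc r)"
  proof (intro exI[of _ \<delta>] conjI \<delta>(1), (intro allI impI))
    fix V :: "'a set" and E H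
    assume lim: "clique_limited (Suc k) (Suc r) V E H"
      and H: "(turan_density (Suc k) (Suc r) - \<delta>) * real (card V) ^ Suc r \<le> real (card H)"
    note L = clique_limitedD[OF lim]
    note F = clique_limited_finite[OF lim]
    show "\<exists>c. (\<forall>v. c v < Suc k) \<and> real (card {e\<in>H. \<not> inj_on c e}) \<le> \<epsilon> * real (card V) ^ Suc r"
    proof (cases "V = {}")
      case True
      then have "H = {}" using L(3,4) by fastforce
      then show ?thesis using \<epsilon> by (intro exI[of _ "\<lambda>_. 0"]) simp
    next
      case False
      have r1: "1 \<le> r" using r by simp
      obtain v where v: "v \<in> V"
        and X: "real (card {e\<in>H. card (e - nbrs V E v) \<ge> 2}) \<le> \<delta> * real (card V) ^ Suc r"
        and h: "(turan_density k r - K * \<delta>) * real (card (nbrs V E v)) ^ r \<le> real (card (link v H))"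
        by (rule near_max_pivot[OF lim r1 r(2) False less_imp_le[OF \<delta>(1)] \<delta>(2)[unfolded D_def] H,
              folded K_def]) (rule that)
      define B where "B = nbrs V E v"
      have BV: "B \<subseteq> V" by (auto simp: B_def nbrs_def)
      have fB: "finite B" using BV L(1) by (rule finite_subset)
      note lk = clique_limited_link[OF lim v, folded B_def]
      have h': "(turan_density k r - d) * real (card B) ^ r \<le> real (card (link v H))" if "K * \<delta> \<le> d" for d
      proof -
        have "(turan_density k r - d) * real (card B) ^ r \<le> (turan_density k r - K * \<delta>) * real (card B) ^ r"
          using that by (intro mult_right_mono) auto
        then show ?thesis using h by (simp add: B_def)
      qed
      obtain c where c: "\<And>v. c v < k"
        and cb: "real (card {e\<in>link v H. \<not> inj_on c e}) \<le> \<delta>1 * real (card B) ^ r"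
        using IH[OF lk h'[OF \<delta>(4)]] by blast
      have ip: "real (card (inner_pairs B E c)) \<le> \<epsilon> / 2 * real (card B) ^ 2"
        using inner[OF lk _ h'[OF \<delta>(5)] cb] c by blast
      define c' where "c' = (\<lambda>v. if v \<in> B then c v else k)"
      let ?I = "inner_pairs B E c"
      \<comment> \<open>An edge with a repeated colour inside \<open>B\<close> contains an inner
        pair, and each of the at most (\<epsilon>/2) n^2 inner pairs lies in at most n^(r-1) sets of
        size r+1.\<close>
      let ?Y = "{X. X \<subseteq> V \<and> card X = Suc r \<and> (\<exists>m\<in>?I. m \<subseteq> X)}"
      have "{e\<in>H. \<not> inj_on c' e} \<subseteq> {e\<in>H. card (e - B) \<ge> 2} \<union> ?Y"
      proof
        fix e assume "e \<in> {e\<in>H. \<not> inj_on c' e}"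
        then have e: "e \<in> H" "\<not> inj_on c' e" by auto
        have "card (e - B) \<ge> 2 \<or> \<not> inj_on c (e \<inter> B)"
          using not_inj_extend[where c = c, OF _ c F(2)[OF e(1)]] e(2) unfolding c'_def by blast
        moreover have "e \<in> ?Y" if n: "\<not> inj_on c (e \<inter> B)"
        proof -
          obtain x y where xy: "x \<in> e \<inter> B" "y \<in> e \<inter> B" "x \<noteq> y" "c x = c y"
            using n by (auto simp: inj_on_def)
          have "{x, y} \<in> ?I"
            using xy L(5)[OF e(1)] by (auto simp: inner_pairs_def clique_def)
          moreover have "{x, y} \<subseteq> e" using xy by auto
          ultimately show ?thesis using L(3,4)[OF e(1)] by blast
        qed
        ultimately show "e \<in> {e\<in>H. card (e - B) \<ge> 2} \<union> ?Y" using e(1) by blast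
      qed
      then have "card {e\<in>H. \<not> inj_on c' e} \<le> card {e\<in>H. card (e - B) \<ge> 2} + card ?Y"
        using F(1) L(1) by (intro card_le_add_of_subset_Un) auto
      moreover have "card ?Y \<le> card ?I * card V ^ (Suc r - 2)"
        using L(1) BV by (intro card_supersets_le finite_inner_pairs fB) (auto simp: inner_pairs_def)
      ultimately have "real (card {e\<in>H. \<not> inj_on c' e})
          \<le> real (card {e\<in>H. card (e - B) \<ge> 2} + card ?I * card V ^ (Suc r - 2))"
        by linarith
      also have "\<dots> \<le> \<delta> * real (card V) ^ Suc r + \<epsilon> / 2 * real (card B) ^ 2 * real (card V) ^ (Suc r - 2)"
        unfolding of_nat_add of_nat_mult of_nat_power
        using X ip by (intro add_mono mult_right_mono) (auto simp only: B_def zero_le_power of_nat_0_le_iff)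
      also have "\<dots> \<le> \<epsilon> / 2 * real (card V) ^ Suc r + \<epsilon> / 2 * real (card V) ^ 2 * real (card V) ^ (Suc r - 2)"
        using \<delta>(3) \<epsilon> card_mono[OF L(1) BV] by (intro add_mono mult_mono power_mono) auto
      also have "\<epsilon> / 2 * real (card V) ^ 2 * real (card V) ^ (Suc r - 2) = \<epsilon> / 2 * real (card V) ^ (2 + (Suc r - 2))"
        by (simp only: power_add mult.assoc)
      also have "2 + (Suc r - 2) = Suc r" using r by simp
      finally have "real (card {e\<in>H. \<not> inj_on c' e}) \<le> \<epsilon> * real (card V) ^ Suc r" by simp
      moreover have "c' v < Suc k" for v using c[of v] by (simp add: c'_def)
      ultimately show ?thesis by blast
    qed
  qed
qed

lemma turan_stable: "2 \<le> r \<Longrightarrow> r \<le> k \<Longrightarrow> turan_stable TYPE('a) k r"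
proof (induction r arbitrary: k rule: nat_induct_at_least)
  case base
  then show ?case using turan_stable_2[of "k - 1", where 'a = 'a] by simp
next
  case (Suc r)
  then obtain l where "k = Suc l" by (cases k) auto
  then show ?case using turan_stable_Suc[of l r, where 'a = 'a] Suc by simp
qed

text \<open>At most \<eta> n^r edges are not rainbow. As \<open>H\<close> is within \<eta> n^r of
  the maximum, which also bounds the rainbow sets, at most 2\<eta> n^r of the latter are missing.
  This explains \<epsilon>/3.\<close>

lemma clique_limited_stability:
  fixes \<epsilon> :: real
  assumes r: "2 \<le> r" "r \<le> k" and \<epsilon>: "\<epsilon> > 0"
  obtains \<delta> :: real where "\<delta> > 0"
    "\<And>(V::'a set) E H. clique_limited k r V E H \<Longrightarrow>
      (turan_density k r - \<delta>) * real (card V) ^ r \<le> real (card H) \<Longrightarrow>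
      \<exists>c. (\<forall>v. c v < k) \<and>
        real (card (H - rainbow V c r) + card (rainbow V c r - H)) \<le> \<epsilon> * real (card V) ^ r \<and>
        (\<forall>i<k. \<bar>real (card {v\<in>V. c v = i}) - real (card V) / real k\<bar> \<le> \<epsilon> * real (card V))"
proof -
  obtain \<delta>1 where \<delta>1: "\<delta>1 > 0" and inner: "\<And>(V::'a set) E H c. clique_limited k r V E H \<Longrightarrow> (\<forall>v\<in>V. c v < k) \<Longrightarrow>
    (turan_density k r - \<delta>1) * real (card V) ^ r \<le> real (card H) \<Longrightarrow>
    real (card {e\<in>H. \<not> inj_on c e}) \<le> \<delta>1 * real (card V) ^ r \<Longrightarrow>
    (\<forall>i<k. \<bar>real (card {v\<in>V. c v = i}) - real (card V) / real k\<bar> \<le> \<epsilon> * real (card V)) \<and>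
    real (card (inner_pairs V E c)) \<le> \<epsilon> * real (card V) ^ 2"
    by (rule few_inner_pairs[OF r \<epsilon>]) (rule that)
  define \<eta> where "\<eta> = min \<delta>1 (\<epsilon> / 3)"
  have \<eta>: "\<eta> > 0" "\<eta> \<le> \<delta>1" "\<eta> \<le> \<epsilon> / 3" using \<delta>1 \<epsilon> by (auto simp: \<eta>_def)
  obtain \<delta>0 where \<delta>0: "\<delta>0 > 0" and st: "\<And>(V::'a set) E H. clique_limited k r V E H \<Longrightarrow>
    (turan_density k r - \<delta>0) * real (card V) ^ r \<le> real (card H) \<Longrightarrow>
    (\<exists>c. (\<forall>v. c v < k) \<and> real (card {e\<in>H. \<not> inj_on c e}) \<le> \<eta> * real (card V) ^ r)"
    by (rule turan_stableE[OF turan_stable[OF r] \<eta>(1)]) (rule that)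
  define \<delta> where "\<delta> = min \<delta>0 \<eta>"
  have \<delta>: "\<delta> > 0" "\<delta> \<le> \<delta>0" "\<delta> \<le> \<eta>" using \<delta>0 \<eta> by (auto simp: \<delta>_def)
  show ?thesis
  proof (rule that[OF \<delta>(1)])
    fix V :: "'a set" and E H
    assume lim: "clique_limited k r V E H"
      and H: "(turan_density k r - \<delta>) * real (card V) ^ r \<le> real (card H)"
    note L = clique_limitedD[OF lim]
    let ?n = "real (card V)"
    have H': "(turan_density k r - d) * ?n ^ r \<le> real (card H)" if "\<delta> \<le> d" for d
    proof -
      have "(turan_density k r - d) * ?n ^ r \<le> (turan_density k r - \<delta>) * ?n ^ r"
        using that by (intro mult_right_mono) auto
      then show ?thesis using H by simp
    qed
    obtain c where c: "\<And>v. c v < k" and bad: "real (card {e\<in>H. \<not> inj_on c e}) \<le> \<eta> * ?n ^ r"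
      using st[OF lim H'[OF \<delta>(2)]] by blast
    have "\<eta> * ?n ^ r \<le> \<delta>1 * ?n ^ r" using \<eta>(2) by (intro mult_right_mono) auto
    then have sz: "\<forall>i<k. \<bar>real (card {v\<in>V. c v = i}) - ?n / real k\<bar> \<le> \<epsilon> * ?n"
      using inner[OF lim _ H'[of \<delta>1]] c bad \<delta> \<eta> by auto
    let ?R = "rainbow V c r"
    have HR: "H - ?R = {e\<in>H. \<not> inj_on c e}" using L(3,4) by (auto simp: rainbow_def)
    have "clique_limited k r V (\<lambda>x y. c x \<noteq> c y) ?R"
      by (rule clique_limited_rainbow[of V c "{..<k}"]) (use L(1) c in auto)
    then have "real (card ?R) \<le> turan_density k r * ?n ^ r" by (rule card_clique_limited_le)
    moreover have "card ?R = card (?R - H) + card (?R \<inter> H)"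
      using card_Int_Diff[OF finite_rainbow[OF L(1)], of c r H] by simp
    moreover have "card H = card (H - ?R) + card (?R \<inter> H)"
      using card_Int_Diff[OF clique_limited_finite(1)[OF lim], of ?R] by (simp add: Int_commute)
    ultimately have "real (card (H - ?R) + card (?R - H)) \<le> 3 * (\<eta> * ?n ^ r)"
      using bad H'[OF \<delta>(3)] unfolding HR by (simp add: algebra_simps)
    also have "\<dots> \<le> \<epsilon> * ?n ^ r" using \<eta>(3) mult_right_mono[OF \<eta>(3), of "?n ^ r"] by simp
    finally show "\<exists>c. (\<forall>v. c v < k) \<and>
      real (card (H - rainbow V c r) + card (rainbow V c r - H)) \<le> \<epsilon> * ?n ^ r \<and>
      (\<forall>i<k. \<bar>real (card {v\<in>V. c v = i}) - ?n / real k\<bar> \<le> \<epsilon> * ?n)"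
      using sz c by blast
  qed
qed

subsection \<open>Embedding $F_m^{(r)}$ through heavy pairs\<close>

text \<open>A fixed s in \<open>S\<close> lies together with x and y in at most n^(r-3) edges, so
  \<open>S\<close> cannot block all edges through a pair with more than D n^(r-3) of them.\<close>

lemma heavy_pair_avoid:
  assumes "finite V" "\<And>e. e \<in> H \<Longrightarrow> e \<subseteq> V \<and> card e = r"
    and "x \<noteq> y" "x \<in> V" "y \<in> V" "x \<notin> S" "y \<notin> S" "finite S" "card S \<le> D"
    and heavy: "card {e\<in>H. {x, y} \<subseteq> e} > D * card V ^ (r - 3)"
  shows "\<exists>e\<in>H. {x, y} \<subseteq> e \<and> e \<inter> S = {}"
proof (rule ccontr)
  assume n: "\<not> ?thesis"
  let ?M = "(\<lambda>s. {x, y, s}) ` (S \<inter> V)"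
  have sub: "{e\<in>H. {x, y} \<subseteq> e} \<subseteq> {X. X \<subseteq> V \<and> card X = r \<and> (\<exists>m\<in>?M. m \<subseteq> X)}"
  proof
    fix e assume e: "e \<in> {e\<in>H. {x, y} \<subseteq> e}"
    then obtain s where "s \<in> e" "s \<in> S" using n by blast
    then show "e \<in> {X. X \<subseteq> V \<and> card X = r \<and> (\<exists>m\<in>?M. m \<subseteq> X)}"
      using e assms(2)[of e] by auto
  qed
  have "card {e\<in>H. {x, y} \<subseteq> e} \<le> card {X. X \<subseteq> V \<and> card X = r \<and> (\<exists>m\<in>?M. m \<subseteq> X)}"
    by (rule card_mono[OF _ sub]) (use assms(1) in simp)
  also have "\<dots> \<le> card ?M * card V ^ (r - 3)"
  proof (rule card_supersets_le)
    show "m \<subseteq> V \<and> card m = 3" if m: "m \<in> ?M" for m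
    proof -
      obtain s where s: "m = {x, y, s}" "s \<in> S" "s \<in> V" using m by auto
      moreover have "s \<noteq> x" "s \<noteq> y" using s assms(6,7) by auto
      ultimately show ?thesis using assms(3-5) by auto
    qed
  qed (use assms(1) in auto)
  also have "\<dots> \<le> D * card V ^ (r - 3)"
  proof (rule mult_right_mono)
    have "card ?M \<le> card (S \<inter> V)" using assms(8) by (intro card_image_le) auto
    also have "\<dots> \<le> card S" using assms(8) by (intro card_mono) auto
    finally show "card ?M \<le> D" using assms(9) by simp
  qed simp
  finally show False using heavy by simp
qed

text \<open>\<open>D\<close> bounds in advance everything that any stage must avoid, namely
  \<open>Q\<close> and all expansions, so one heaviness threshold serves every stage.\<close>

lemma greedy_expansions:
  fixes a b :: "'i \<Rightarrow> 'a"
  assumes "finite V" "\<And>e. e \<in> H \<Longrightarrow> e \<subseteq> V \<and> card e = r" "r \<ge> 3" "Q \<subseteq> V" "finite I"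
    and "\<And>i. i \<in> I \<Longrightarrow> a i \<in> Q \<and> b i \<in> Q \<and> a i \<noteq> b i \<and>
           card {e\<in>H. {a i, b i} \<subseteq> e} > D * card V ^ (r - 3)"
    and "card Q + card I * r \<le> D"
  shows "\<exists>g. (\<forall>i\<in>I. g i \<union> {a i, b i} \<in> H \<and> g i \<inter> Q = {} \<and> card (g i) = r - 2) \<and>
             disjoint_family_on g I"
  using assms(5,6,7)
proof (induction I)
  case empty
  then show ?case by (auto simp: disjoint_family_on_def)
next
  case (insert i I)
  have "card Q + card I * r \<le> D" using insert.prems(2) insert.hyps by simp
  then obtain g where g: "\<And>j. j \<in> I \<Longrightarrow> g j \<union> {a j, b j} \<in> H \<and> g j \<inter> Q = {} \<and> card (g j) = r - 2"
    and dg: "disjoint_family_on g I"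
    using insert.IH insert.prems(1) by auto
  have ab: "a i \<in> Q" "b i \<in> Q" "a i \<noteq> b i" "card {e\<in>H. {a i, b i} \<subseteq> e} > D * card V ^ (r - 3)"
    using insert.prems(1) by auto
  have fQ: "finite Q" using assms(1,4) by (rule finite_subset[rotated])
  have fg: "finite (g j)" if "j \<in> I" for j
    using g[OF that] assms(3) by (intro card_ge_0_finite) auto
  define U where "U = (\<Union>j\<in>I. g j)"
  \<comment> \<open>The two ends of the current pair are exempt, since the new edge must contain
    them.\<close>
  define S where "S = (Q - {a i, b i}) \<union> U"
  have UQ: "U \<inter> Q = {}" using g by (auto simp: U_def)
  have fS: "finite S" using fQ fg insert.hyps(1) by (auto simp: S_def U_def)
  have "card U \<le> (\<Sum>j\<in>I. card (g j))" unfolding U_def by (rule card_UN_le[OF insert.hyps(1)])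
  also have "\<dots> = card I * (r - 2)" using g by simp
  also have "\<dots> \<le> card I * r" by simp
  finally have "card S \<le> card Q + card I * r"
    unfolding S_def by (meson add_mono card_Un_le card_mono fQ Diff_subset le_trans)
  also have "\<dots> \<le> D" by fact
  finally have "\<exists>e\<in>H. {a i, b i} \<subseteq> e \<and> e \<inter> S = {}"
    using ab assms(4) UQ fS by (intro heavy_pair_avoid[where D = D, OF assms(1,2)]) (auto simp: S_def)
  then obtain e where e: "e \<in> H" "{a i, b i} \<subseteq> e" "e \<inter> S = {}" by blast
  define g' where "g' = g(i := e - {a i, b i})"
  have "finite e" using e(1) assms(1,2) by (meson finite_subset)
  then have "card (e - {a i, b i}) = r - 2"
    using e(1,2) assms(2)[of e] ab(3) by (subst card_Diff_subset) auto
  moreover have "(e - {a i, b i}) \<inter> Q = {}" using e(3) by (auto simp: S_def)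
  moreover have "e - {a i, b i} \<union> {a i, b i} = e" using e(2) by blast
  ultimately have "\<forall>j\<in>insert i I. g' j \<union> {a j, b j} \<in> H \<and> g' j \<inter> Q = {} \<and> card (g' j) = r - 2"
    using g e(1) insert.hyps(2) by (auto simp: g'_def)
  moreover have "disjoint_family_on g' (insert i I)"
  proof -
    have "g' j = g j" if "j \<in> I" for j using that insert.hyps(2) by (auto simp: g'_def)
    then have "disjoint_family_on g' I" using dg by (simp add: disjoint_family_on_def)
    moreover have "g' i \<inter> g' j = {}" if "j \<in> I" for j
      using that e(3) insert.hyps(2) by (auto simp: g'_def S_def U_def)
    ultimately show ?thesis using insert.hyps(2) by (auto simp: disjoint_family_on_def)
  qed
  ultimately show ?case by blast
qed

lemma F_graph_embeds:
  fixes H :: "'a hypergraph"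
  assumes e: "e \<in> edges H" "bij_betw f {1..m} Q" "f ` {1..r} = e" and V: "Q \<subseteq> verts H"
    and sub: "\<And>e. e \<in> edges H \<Longrightarrow> e \<subseteq> verts H" and rm: "r \<le> m"
    and g: "\<And>i j. (i, j) \<in> F_pairs r m \<Longrightarrow>
      g (i, j) \<union> {f i, f j} \<in> edges H \<and> g (i, j) \<inter> Q = {} \<and> finite (g (i, j)) \<and> card (g (i, j)) = r - 2"
    and dis: "disjoint_family_on g (F_pairs r m)"
  shows "\<not> is_free (F_graph r m) H"
proof -
  have "\<exists>h. bij_betw h {1..r - 2} (g p)" if "p \<in> F_pairs r m" for p
    using g[of "fst p" "snd p"] that by (intro finite_same_card_bij) auto
  then obtain h where h: "\<And>p. p \<in> F_pairs r m \<Longrightarrow> bij_betw (h p) {1..r - 2} (g p)" by metis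
  define \<phi> where "\<phi> = (\<lambda>v. case v of Core i \<Rightarrow> f i | Expansion i j t \<Rightarrow> h (i, j) t)"
  have \<phi>C: "\<phi> (Core i) = f i" and \<phi>E: "\<phi> (Expansion i j t) = h (i, j) t" for i j t
    by (auto simp: \<phi>_def)
  have imE: "\<phi> ` F_expansion r i j = g (i, j)" if "(i, j) \<in> F_pairs r m" for i j
    using bij_betw_imp_surj_on[OF h[OF that]] by (simp add: F_expansion_def image_image \<phi>E)
  have imC: "\<phi> ` Core ` {1..m} = Q" using bij_betw_imp_surj_on[OF e(2)] by (simp add: image_image \<phi>C)
  let ?F = "F_graph r m"
  have inj: "inj_on \<phi> (verts ?F)"
  proof (rule inj_onI)
    have C: "\<phi> v \<in> Q" if "v \<in> Core ` {1..m}" for v using that imC by blast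
    have E: "\<phi> (Expansion i j t) \<in> g (i, j)" "t \<in> {1..r - 2}" "(i, j) \<in> F_pairs r m"
      if "Expansion i j t \<in> verts ?F" for i j t
      using that imE[of i j] by (auto simp: F_graph_def F_expansion_def)
    have C': "i \<in> {1..m}" if "Core i \<in> verts ?F" for i
      using that by (auto simp: F_graph_def F_expansion_def)
    fix u w assume uw: "u \<in> verts ?F" "w \<in> verts ?F" "\<phi> u = \<phi> w"
    show "u = w"
    proof (cases u)
      case u: (Core i)
      show ?thesis
      proof (cases w)
        case w: (Core j)
        then show ?thesis using uw u C'[of i] C'[of j] bij_betw_imp_inj_on[OF e(2)]
          by (auto simp: \<phi>C dest: inj_onD)
      next
        case w: (Expansion i' j' t)
        then show ?thesis using uw u C'[of i] C[of "Core i"] E[of i' j' t] g[of i' j'] by auto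
      qed
    next
      case u: (Expansion i j t)
      show ?thesis
      proof (cases w)
        case w: (Core i')
        then show ?thesis using uw u C'[of i'] C[of "Core i'"] E[of i j t] g[of i j] by auto
      next
        case w: (Expansion i' j' t')
        have "(i, j) = (i', j')"
          using dis uw u w E[of i j t] E[of i' j' t'] unfolding disjoint_family_on_def by (metis disjoint_iff)
        then show ?thesis using u w uw E[of i j t] E[of i' j' t'] bij_betw_imp_inj_on[OF h[of "(i, j)"]]
          by (auto simp: \<phi>E dest: inj_onD)
      qed
    qed
  qed
  define G where "G = \<lparr>verts = \<phi> ` verts ?F, edges = (\<lambda>e. \<phi> ` e) ` edges ?F\<rparr>"
  have iso: "isomorphic ?F G"
    unfolding isomorphic_def G_def by (rule exI[of _ \<phi>]) (simp add: inj bij_betw_def)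
  have edge_in: "\<phi> ` d \<in> edges H" if d: "d \<in> edges ?F" for d
  proof -
    consider "d = Core ` {1..r}"
      | i j where "(i, j) \<in> F_pairs r m" "d = F_expansion r i j \<union> {Core i, Core j}"
      using d by (auto simp: F_graph_def)
    then show ?thesis
    proof cases
      case 1
      then show ?thesis using e by (simp add: image_image \<phi>C)
    next
      case 2
      then have "\<phi> ` d = g (i, j) \<union> {f i, f j}" using imE[of i j] by (simp add: image_Un \<phi>C)
      then show ?thesis using g 2 by simp
    qed
  qed
  have "subgraph G H"
    unfolding subgraph_def
  proof (intro conjI ballI)
    show "edges G \<subseteq> edges H" using edge_in by (auto simp: G_def)
    show "verts G \<subseteq> verts H"
    proof
      fix u assume "u \<in> verts G"
      then obtain w where w: "w \<in> verts ?F" "u = \<phi> w" by (auto simp: G_def)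
      then consider "w \<in> Core ` {1..m}" | i j where "(i, j) \<in> F_pairs r m" "w \<in> F_expansion r i j"
        by (auto simp: F_graph_def)
      then show "u \<in> verts H"
      proof cases
        case 1
        then show ?thesis using w imC V by blast
      next
        case 2
        then have "u \<in> g (i, j)" using imE w by blast
        then show ?thesis using g[OF 2(1)] sub by blast
      qed
    qed
    fix d assume "d \<in> edges G"
    then obtain d' where d': "d' \<in> edges ?F" "d = \<phi> ` d'" by (auto simp: G_def)
    have "d' \<subseteq> verts ?F"
      using d'(1) rm by (fastforce simp: F_graph_def F_pairs_def)
    then show "d \<subseteq> verts G" using d'(2) by (auto simp: G_def)
  qed
  then show ?thesis using iso unfolding is_free_def by blast
qed

text \<open>\<open>D\<close> counts k+1 core vertices and at most (k+1)^2 expansions of fewer than r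
  vertices each. A deleted edge contains one of at most n^2 light pairs, and each of these lies in
  at most D n^(r-3) edges.\<close>

lemma F_free_reduction:
  fixes H :: "'a hypergraph"
  assumes H: "r_graph r H" and free: "is_free (F_graph r (k + 1)) H" and r: "3 \<le> r" "r \<le> k"
  defines "D \<equiv> (k + 1) + (k + 1)\<^sup>2 * r"
  obtains E H' where "clique_limited k r (verts H) E H'" "H' \<subseteq> edges H"
    "card (edges H - H') \<le> D * card (verts H) ^ (r - 1)"
proof -
  define V where "V = verts H"
  have fV: "finite V" and eV: "\<And>e. e \<in> edges H \<Longrightarrow> e \<subseteq> V \<and> card e = r"
    using H by (auto simp: r_graph_def V_def)
  have "edges H \<subseteq> Pow V" using eV by blast
  then have fH: "finite (edges H)" using fV by (simp add: finite_subset)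
  define E where "E = (\<lambda>x y. card {e\<in>edges H. {x, y} \<subseteq> e} > D * card V ^ (r - 3))"
  define H' where "H' = {e\<in>edges H. clique E e}"
  have "clique_limited k r V E H'"
    unfolding clique_limited_def
  proof (intro conjI allI impI ballI)
    show "symp E" by (simp add: symp_def E_def conj_commute)
    fix Q0 e assume Q0: "Q0 \<subseteq> V" "clique E Q0" and e: "e \<in> H'" "e \<subseteq> Q0"
    show "card Q0 \<le> k"
    proof (rule ccontr)
      assume n: "\<not> card Q0 \<le> k"
      have fQ0: "finite Q0" using Q0(1) fV by (rule finite_subset)
      have ce: "card e = r" "e \<in> edges H" using e(1) eV by (auto simp: H'_def)
      \<comment> \<open>The large clique is cut down to k+1 vertices that still include
        \<open>e\<close>, which takes the place of the core edge [r].\<close>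
      obtain Q where Q: "e \<subseteq> Q" "Q \<subseteq> Q0" "card Q = k + 1"
        using exists_subset_between[of e "k + 1" Q0] ce n e(2) fQ0 r by auto
      have cQ: "clique E Q" using Q0(2) Q(2) by (auto simp: clique_def)
      have QV: "Q \<subseteq> V" using Q(2) Q0(1) by simp
      have fQ: "finite Q" using QV fV by (rule finite_subset)
      have fe: "finite e" using Q(1) fQ by (rule finite_subset)
      obtain f1 where f1: "bij_betw f1 {1..r} e"
        using finite_same_card_bij[of "{1..r}" e] fe ce by auto
      obtain f2 where f2: "bij_betw f2 {r + 1..k + 1} (Q - e)"
        using finite_same_card_bij[of "{r + 1..k + 1}" "Q - e"] fQ fe Q ce r by (auto simp: card_Diff_subset)
      define f where "f = (\<lambda>x. if x \<in> {1..r} then f1 x else f2 x)"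
      have "bij_betw f ({1..r} \<union> {r + 1..k + 1}) (e \<union> (Q - e))"
        unfolding f_def by (rule bij_betw_disjoint_Un[OF f1 f2]) auto
      moreover have "{1..r} \<union> {r + 1..k + 1} = {1..k + 1}" using r by auto
      moreover have "e \<union> (Q - e) = Q" using Q(1) by blast
      ultimately have f: "bij_betw f {1..k + 1} Q" by simp
      have fr: "f ` {1..r} = e" using bij_betw_imp_surj_on[OF f1] by (simp add: f_def)
      let ?P = "F_pairs r (k + 1)"
      have P: "?P \<subseteq> {1..k + 1} \<times> {1..k + 1}" by (auto simp: F_pairs_def)
      have fP: "finite ?P" using P by (rule finite_subset) simp
      have "card ?P \<le> card ({1..k + 1} \<times> {1..k + 1})" using P by (intro card_mono) auto
      then have cP: "card ?P \<le> (k + 1)\<^sup>2" by (simp add: card_cartesian_product power2_eq_square)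
      have "\<exists>g. (\<forall>p\<in>?P. g p \<union> {f (fst p), f (snd p)} \<in> edges H \<and> g p \<inter> Q = {} \<and> card (g p) = r - 2) \<and>
             disjoint_family_on g ?P"
      proof (rule greedy_expansions[OF fV eV r(1) QV fP, where D = D])
        show "card Q + card ?P * r \<le> D" using cP Q(3) by (simp add: D_def)
        fix p assume "p \<in> ?P"
        then have p: "fst p \<in> {1..k + 1}" "snd p \<in> {1..k + 1}" "fst p \<noteq> snd p"
          by (auto simp: F_pairs_def)
        have "f (fst p) \<in> Q" "f (snd p) \<in> Q" "f (fst p) \<noteq> f (snd p)"
          using p f by (auto simp: bij_betw_def dest: inj_onD)
        then show "f (fst p) \<in> Q \<and> f (snd p) \<in> Q \<and> f (fst p) \<noteq> f (snd p) \<and>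
            D * card V ^ (r - 3) < card {e\<in>edges H. {f (fst p), f (snd p)} \<subseteq> e}"
          using cQ by (auto simp: clique_def E_def)
      qed
      then obtain g where g: "\<And>p. p \<in> ?P \<Longrightarrow> g p \<union> {f (fst p), f (snd p)} \<in> edges H \<and> g p \<inter> Q = {} \<and> card (g p) = r - 2"
        and dg: "disjoint_family_on g ?P" by blast
      have "\<not> is_free (F_graph r (k + 1)) H"
      proof (rule F_graph_embeds[OF ce(2) f fr])
        show "disjoint_family_on g ?P" by (rule dg)
        fix i j assume "(i, j) \<in> ?P"
        then show "g (i, j) \<union> {f i, f j} \<in> edges H \<and> g (i, j) \<inter> Q = {} \<and> finite (g (i, j)) \<and> card (g (i, j)) = r - 2"
          using g[of "(i, j)"] r(1) by (auto intro: card_ge_0_finite)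
      qed (use QV eV r in \<open>auto simp: V_def\<close>)
      then show False using free by simp
    qed
  qed (use fV eV in \<open>auto simp: H'_def\<close>)
  moreover have "card (edges H - H') \<le> D * card V ^ (r - 1)"
  proof -
    let ?L = "{(x, y). x \<in> V \<and> y \<in> V \<and> \<not> E x y}"
    have L: "?L \<subseteq> V \<times> V" by auto
    have fL: "finite ?L" using L fV by (meson finite_SigmaI finite_subset)
    have "edges H - H' \<subseteq> (\<Union>p\<in>?L. {e\<in>edges H. {fst p, snd p} \<subseteq> e})"
      using eV by (fastforce simp: H'_def clique_def)
    then have "card (edges H - H') \<le> card (\<Union>p\<in>?L. {e\<in>edges H. {fst p, snd p} \<subseteq> e})"
      using fL fH by (intro card_mono) auto
    also have "\<dots> \<le> (\<Sum>p\<in>?L. card {e\<in>edges H. {fst p, snd p} \<subseteq> e})" by (rule card_UN_le[OF fL])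
    also have "\<dots> \<le> (\<Sum>p\<in>?L. D * card V ^ (r - 3))" by (intro sum_mono) (auto simp: E_def)
    also have "\<dots> = card ?L * (D * card V ^ (r - 3))" by simp
    also have "\<dots> \<le> (card V * card V) * (D * card V ^ (r - 3))"
      using card_mono[OF _ L] fV by (intro mult_right_mono) (auto simp: card_cartesian_product)
    also have "\<dots> = D * card V ^ (2 + (r - 3))" by (simp add: power_add power2_eq_square)
    also have "2 + (r - 3) = r - 1" using r by simp
    finally show ?thesis .
  qed
  ultimately show ?thesis using that[of E H'] by (auto simp: V_def H'_def)
qed

subsection \<open>From the spectral radius to the number of edges\<close>

text \<open>Hoelder against the constant function 1. Dividing by \<alpha> and \<beta> normalises
  both factors, and Young's inequality applied termwise sums to 1/p + 1/q = 1.\<close>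

lemma sum_le_card_powr:
  fixes z :: "'a \<Rightarrow> real"
  assumes "finite A" "\<And>i. i \<in> A \<Longrightarrow> z i \<ge> 0" "p > 1"
  shows "sum z A \<le> real (card A) powr (1 - 1 / p) * (\<Sum>i\<in>A. z i powr p) powr (1 / p)"
proof (cases "(\<Sum>i\<in>A. z i powr p) = 0")
  case True
  then have "z i = 0" if "i \<in> A" for i
    using that assms by (simp add: sum_nonneg_eq_0_iff)
  then show ?thesis by simp
next
  case False
  define S N where "S = (\<Sum>i\<in>A. z i powr p)" and "N = real (card A)"
  have "S \<ge> 0" unfolding S_def by (intro sum_nonneg) auto
  then have S: "S > 0" using False by (simp add: S_def)
  have "A \<noteq> {}" using False by auto
  then have N: "N > 0" using assms(1) by (simp add: N_def card_gt_0_iff)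
  define q where "q = p / (p - 1)"
  have q: "q > 1" "1 / p + 1 / q = 1"
    using assms(3) by (auto simp: q_def field_simps)
  define \<alpha> \<beta> where "\<alpha> = S powr (1 / p)" and "\<beta> = N powr (1 - 1 / p)"
  have pos: "\<alpha> > 0" "\<beta> > 0" using S N by (auto simp: \<alpha>_def \<beta>_def)
  have ap: "\<alpha> powr p = S" using S assms(3) by (simp add: \<alpha>_def powr_powr)
  have "(1 - 1 / p) * q = 1" using assms(3) by (simp add: q_def field_simps)
  then have bq: "\<beta> powr q = N" using N by (simp add: \<beta>_def powr_powr)
  have "sum z A / (\<alpha> * \<beta>) = (\<Sum>i\<in>A. z i / \<alpha> * (1 / \<beta>))" by (simp add: sum_divide_distrib)
  also have "\<dots> \<le> (\<Sum>i\<in>A. (z i / \<alpha>) powr p / p + (1 / \<beta>) powr q / q)"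
    using assms q pos by (intro sum_mono Youngs_inequality) auto
  also have "\<dots> = (\<Sum>i\<in>A. z i powr p / S / p + 1 / N / q)"
    using assms(2) pos by (intro sum.cong refl) (simp add: powr_divide ap bq)
  also have "\<dots> = 1 / p + 1 / q"
    using S N by (simp add: sum.distrib flip: sum_divide_distrib S_def N_def)
  finally have "sum z A / (\<alpha> * \<beta>) \<le> 1" using q by simp
  then show ?thesis using pos by (simp add: S_def N_def \<alpha>_def \<beta>_def mult.commute)
qed

lemma prod_powr_real:
  fixes f :: "'a \<Rightarrow> real"
  assumes "\<And>i. i \<in> A \<Longrightarrow> f i \<ge> 0"
  shows "(\<Prod>i\<in>A. f i) powr p = (\<Prod>i\<in>A. f i powr p)"
  using assms by (induction A rule: infinite_finite_induct) (auto simp: powr_mult prod_nonneg)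

lemma sum_prod_le_weight:
  fixes x :: "'a \<Rightarrow> real"
  assumes "finite H" "p > 1"
  shows "(\<Sum>e\<in>H. \<Prod>v\<in>e. x v)
     \<le> real (card H) powr (1 - 1 / p) * weight (\<lambda>v. \<bar>x v\<bar> powr p) H powr (1 / p)"
proof -
  have "(\<Sum>e\<in>H. \<Prod>v\<in>e. x v) \<le> (\<Sum>e\<in>H. \<Prod>v\<in>e. \<bar>x v\<bar>)"
    by (intro sum_mono) (simp flip: abs_prod)
  also have "\<dots> \<le> real (card H) powr (1 - 1 / p) * (\<Sum>e\<in>H. (\<Prod>v\<in>e. \<bar>x v\<bar>) powr p) powr (1 / p)"
    by (intro sum_le_card_powr assms prod_nonneg) auto
  also have "(\<Sum>e\<in>H. (\<Prod>v\<in>e. \<bar>x v\<bar>) powr p) = weight (\<lambda>v. \<bar>x v\<bar> powr p) H"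
    by (simp add: weight_def prod_powr_real)
  finally show ?thesis .
qed

text \<open>A crude bound for the deleted edges, which have no clique structure: every pair is taken
  as adjacent, with clique bound |V|.\<close>

lemma weight_uniform_le_1:
  assumes "finite V" "\<And>e. e \<in> H \<Longrightarrow> e \<subseteq> V \<and> card e = r" "\<And>v. v \<in> V \<Longrightarrow> y v \<ge> 0" "sum y V = 1"
  shows "weight y H \<le> 1"
proof -
  have "clique_limited (card V) r V (\<lambda>_ _. True) H"
    using assms(1,2) by (auto simp: clique_limited_def clique_def symp_def card_mono)
  then have "weight y H \<le> turan_density (card V) r" 
    using weight_clique_limited_le[where y = y] assms(3,4) by fastforce
  also have "\<dots> \<le> 1"
  proof -
    have "card V choose r \<le> card V ^ r" by (rule binomial_le_power)
    then have "real (card V choose r) \<le> real (card V) ^ r" by (metis of_nat_le_iff of_nat_power)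
    then show ?thesis by (auto simp: turan_density_def divide_le_eq_1)
  qed
  finally show ?thesis .
qed

text \<open>The vector |x|^p has total weight 1, so the extremal bound makes the weight factor of
  Hoelder independent of x. What remains depends only on the numbers of kept and deleted
  edges.\<close>

lemma sum_prod_clique_limited_le:
  fixes x :: "'a \<Rightarrow> real"
  assumes "clique_limited k r V E H'" "p > 1" "H' \<subseteq> H" "\<And>e. e \<in> H \<Longrightarrow> e \<subseteq> V \<and> card e = r"
    and "(\<Sum>v\<in>V. \<bar>x v\<bar> powr p) = 1"
  shows "(\<Sum>e\<in>H. \<Prod>v\<in>e. x v) \<le> real (card H') powr (1 - 1 / p) * turan_density k r powr (1 / p)
           + real (card (H - H')) powr (1 - 1 / p)"
proof -
  have fV: "finite V" using clique_limitedD(1)[OF assms(1)] .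
  have "H \<subseteq> Pow V" using assms(4) by blast
  then have fH: "finite H" using fV by (simp add: finite_subset)
  let ?y = "\<lambda>v. \<bar>x v\<bar> powr p"
  have nn: "weight ?y K \<ge> 0" for K unfolding weight_def by (intro sum_nonneg prod_nonneg) auto
  have "(\<Sum>e\<in>H. \<Prod>v\<in>e. x v) = (\<Sum>e\<in>H - H'. \<Prod>v\<in>e. x v) + (\<Sum>e\<in>H'. \<Prod>v\<in>e. x v)"
    by (rule sum.subset_diff[OF assms(3) fH])
  moreover have "(\<Sum>e\<in>H'. \<Prod>v\<in>e. x v) \<le> real (card H') powr (1 - 1 / p) * turan_density k r powr (1 / p)"
  proof -
    have "weight ?y H' \<le> turan_density k r"
      using weight_clique_limited_le[OF assms(1), of ?y] assms(5) by simp
    then have "weight ?y H' powr (1 / p) \<le> turan_density k r powr (1 / p)"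
      using assms(2) nn by (intro powr_mono2) auto
    then show ?thesis
      using sum_prod_le_weight[OF finite_subset[OF assms(3) fH] assms(2), of x]
      by (meson mult_left_mono order_trans powr_ge_zero)
  qed
  moreover have "(\<Sum>e\<in>H - H'. \<Prod>v\<in>e. x v) \<le> real (card (H - H')) powr (1 - 1 / p) * 1"
  proof -
    have "weight ?y (H - H') \<le> 1"
      by (rule weight_uniform_le_1[OF fV]) (use assms(4,5) in auto)
    then have "weight ?y (H - H') powr (1 / p) \<le> 1 powr (1 / p)"
      using assms(2) nn by (intro powr_mono2) auto
    then have "weight ?y (H - H') powr (1 / p) \<le> 1" by simp
    then show ?thesis
      using sum_prod_le_weight[of "H - H'" p x] fH assms(2)
      by (meson finite_Diff mult_left_mono order_trans powr_ge_zero)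
  qed
  ultimately show ?thesis by simp
qed

lemma falling_factorial_eq: "falling_factorial k r = fact r * real (k choose r)"
  by (simp add: falling_factorial_def binomial_gbinomial gbinomial_prod_rev atLeast0LessThan)

lemma spectral_imp_many_edges:
  fixes p :: real
  assumes p: "p > 1" and r: "r \<ge> 1" "r \<le> k" and \<delta>1: "\<delta>1 > 0"
  obtains \<delta> \<kappa> :: real where "\<delta> > 0" "\<kappa> > 0"
    "\<And>(H :: 'a hypergraph) E H'. r_graph r H \<Longrightarrow> verts H \<noteq> {} \<Longrightarrow>
      clique_limited k r (verts H) E H' \<Longrightarrow> H' \<subseteq> edges H \<Longrightarrow>
      real (card (edges H - H')) \<le> \<kappa> * real (card (verts H)) ^ r \<Longrightarrow>
      p_spectral_radius r p H > (1 - \<delta>) * (falling_factorial k r / real k ^ r)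
        * real (card (verts H)) powr (real r * (1 - 1 / p)) \<Longrightarrow>
      (turan_density k r - \<delta>1) * real (card (verts H)) ^ r \<le> real (card H')"
proof -
  define D s where "D = turan_density k r" and "s = 1 - 1 / p"
  have D: "D > 0" using r by (simp add: D_def turan_density_pos)
  have s: "s > 0" "s + 1 / p = 1" using p by (auto simp: s_def)
  \<comment> \<open>Truncation keeps the base of \<open>powr\<close> nonnegative when \<delta>1
    exceeds D.\<close>
  define d where "d = max 0 (D - \<delta>1)"
  have d: "0 \<le> d" "d < D" "D - \<delta>1 \<le> d" using D \<delta>1 by (auto simp: d_def)
  \<comment> \<open>Half of the drop in the main term when the edge density falls from D to d. One
    half pays for the loss \<delta> = \<gamma>/D in the hypothesis, the other for the deleted edges,
    whose share \<kappa> = \<gamma> powr (1/s) contributes \<gamma> once raised to the power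
    s.\<close>
  define \<gamma> where "\<gamma> = (D - d powr s * D powr (1 / p)) / 2"
  have "d powr s * D powr (1 / p) < D powr s * D powr (1 / p)"
    using d s D by (intro mult_strict_right_mono powr_less_mono2) auto
  also have "\<dots> = D" using D s(2) by (simp flip: powr_add)
  finally have \<gamma>: "\<gamma> > 0" by (simp add: \<gamma>_def)
  have "\<gamma> / D > 0" "\<gamma> powr (1 / s) > 0" using \<gamma> D by auto
  then show ?thesis
  proof (rule that)
    fix H :: "'a hypergraph" and E H'
    assume H: "r_graph r H" and ne: "verts H \<noteq> {}" and lim: "clique_limited k r (verts H) E H'"
      and H': "H' \<subseteq> edges H"
      and del: "real (card (edges H - H')) \<le> \<gamma> powr (1 / s) * real (card (verts H)) ^ r"
      and big: "p_spectral_radius r p H > (1 - \<gamma> / D) * (falling_factorial k r / real k ^ r)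
        * real (card (verts H)) powr (real r * (1 - 1 / p))"
    define N where "N = real (card (verts H)) ^ r"
    have n: "real (card (verts H)) > 0" using ne H by (simp add: r_graph_def card_gt_0_iff)
    have N: "N > 0" using n by (simp add: N_def)
    have Ns: "real (card (verts H)) powr (real r * (1 - 1 / p)) = N powr s"
      using n by (simp add: N_def s_def powr_powr flip: powr_realpow)
    obtain x where x: "p_norm p (verts H) x = 1" "lagrange_poly r H x = p_spectral_radius r p H"
      using p_spectral_radius_attained[OF H ne less_imp_le[OF p]] by blast
    define S where "S = (\<Sum>e\<in>edges H. \<Prod>v\<in>e. x v)"
    have "fact r * S > (1 - \<gamma> / D) * (fact r * D) * N powr s"
      using big x(2) unfolding lagrange_poly_def S_def[symmetric] Ns
      by (simp add: falling_factorial_eq D_def turan_density_def)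
    then have "fact r * ((1 - \<gamma> / D) * D * N powr s) < fact r * S" by (simp add: mult_ac)
    then have "(1 - \<gamma> / D) * D * N powr s < S" by (simp add: mult_less_cancel_left_pos)
    then have S_low: "(D - \<gamma>) * N powr s < S" using D by (simp add: left_diff_distrib)
    have x1: "(\<Sum>v\<in>verts H. \<bar>x v\<bar> powr p) = 1" using p_norm_eq_1_iff[THEN iffD1, OF _ x(1)] p by simp
    have S_up: "S \<le> real (card H') powr s * D powr (1 / p) + real (card (edges H - H')) powr s"
      unfolding S_def s_def D_def
      by (rule sum_prod_clique_limited_le[OF lim p H' _ x1]) (use H in \<open>auto simp: r_graph_def\<close>)
    have "real (card (edges H - H')) powr s \<le> (\<gamma> powr (1 / s) * N) powr s"
      using del s by (intro powr_mono2) (auto simp: N_def)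
    also have "\<dots> = \<gamma> * N powr s" using \<gamma> N s by (simp add: powr_mult powr_powr)
    finally have del': "real (card (edges H - H')) powr s \<le> \<gamma> * N powr s" .
    have "(D - \<delta>1) * N \<le> real (card H')"
    proof (rule ccontr)
      assume "\<not> ?thesis"
      then have "real (card H') \<le> (D - \<delta>1) * N" by simp
      also have "\<dots> \<le> d * N" using d N by (intro mult_right_mono) auto
      finally have "real (card H') powr s \<le> (d * N) powr s" using s by (intro powr_mono2) auto
      then have "real (card H') powr s * D powr (1 / p) \<le> (d * N) powr s * D powr (1 / p)"
        by (intro mult_right_mono) auto
      also have "\<dots> = (d powr s * D powr (1 / p)) * N powr s" using d N by (simp add: powr_mult)
      also have "d powr s * D powr (1 / p) = D - 2 * \<gamma>" unfolding \<gamma>_def by argo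
      finally have "S \<le> (D - 2 * \<gamma>) * N powr s + \<gamma> * N powr s" using S_up del' by linarith
      then show False using S_low by (simp add: algebra_simps)
    qed
    then show "(turan_density k r - \<delta>1) * real (card (verts H)) ^ r \<le> real (card H')"
      by (simp add: D_def N_def)
  qed
qed

subsection \<open>Balancing the parts\<close>

lemma sum_card_colour_classes:
  assumes "finite V" "\<And>v. v \<in> V \<Longrightarrow> c v < (k::nat)"
  shows "(\<Sum>i<k. card {v\<in>V. c v = i}) = card V"
proof -
  have "(\<Sum>i<k. \<Sum>v\<in>{v\<in>V. c v = i}. 1) = (\<Sum>v\<in>V. 1::nat)"
    by (rule sum.group) (use assms in auto)
  then show ?thesis by simp
qed

text \<open>Truncated subtraction counts only the overfull classes. While one exists, equality of
  the sums yields an underfull class, and moving one vertex lowers the total excess by exactly one;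
  when the excess is zero, equal sums force equal sizes.\<close>

lemma recolour:
  fixes c :: "'a \<Rightarrow> nat"
  assumes "finite V" "\<And>v. v \<in> V \<Longrightarrow> c v < k" "(\<Sum>i<k. m i) = card V"
  shows "\<exists>c'. (\<forall>v\<in>V. c' v < k) \<and> (\<forall>i<k. card {v\<in>V. c' v = i} = m i) \<and>
     card {v\<in>V. c' v \<noteq> c v} \<le> (\<Sum>i<k. card {v\<in>V. c v = i} - m i)"
  using assms(2)
proof (induction "\<Sum>i<k. card {v\<in>V. c v = i} - m i" arbitrary: c)
  case 0
  then have le: "card {v\<in>V. c v = i} \<le> m i" if "i < k" for i using that by auto
  have "card {v\<in>V. c v = i} = m i" if "i < k" for i
    by (rule sum_mono_inv[where I = "{..<k}"])
      (use that le sum_card_colour_classes[OF assms(1) 0(2)] assms(3) in auto)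
  then show ?case using 0 by (intro exI[of _ c]) auto
next
  case (Suc N c)
  let ?s = "\<lambda>c i. card {v\<in>V. c v = i}"
  have sum_s: "(\<Sum>i<k. ?s c i) = (\<Sum>i<k. m i)" using sum_card_colour_classes[OF assms(1) Suc.prems] assms(3) by simp
  obtain i where i: "i < k" "?s c i > m i"
  proof (rule ccontr)
    assume "\<not> thesis"
    then have "\<And>i. i < k \<Longrightarrow> ?s c i - m i = 0" using that by fastforce
    then show False using Suc.hyps(2) by simp
  qed
  obtain j where j: "j < k" "?s c j < m j"
  proof (rule ccontr)
    assume "\<not> thesis"
    then have "\<And>l. l < k \<Longrightarrow> m l \<le> ?s c l" using that by fastforce
    then have "(\<Sum>l<k. m l) < (\<Sum>l<k. ?s c l)" using i by (intro sum_strict_mono_ex1) auto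
    then show False using sum_s by simp
  qed
  have ij: "i \<noteq> j" using i j by auto
  obtain v where v: "v \<in> V" "c v = i"
    using i(2) by (metis (mono_tags, lifting) card.empty empty_Collect_eq not_less_zero)
  define d where "d = c(v := j)"
  have di: "?s d i = ?s c i - 1"
  proof -
    have "{u\<in>V. d u = i} = {u\<in>V. c u = i} - {v}" using ij by (auto simp: d_def)
    then show ?thesis using v by simp
  qed
  have dj: "?s d j = ?s c j + 1"
  proof -
    have "{u\<in>V. d u = j} = insert v {u\<in>V. c u = j}" using v by (auto simp: d_def)
    then show ?thesis using v ij assms(1) by simp
  qed
  have dl: "?s d l = ?s c l" if "l \<noteq> i" "l \<noteq> j" for l
  proof -
    have "{u\<in>V. d u = l} = {u\<in>V. c u = l}" using v that by (auto simp: d_def)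
    then show ?thesis by simp
  qed
  have "(\<Sum>l<k. ?s c l - m l) = (?s c i - m i) + (\<Sum>l\<in>{..<k} - {i}. ?s c l - m l)"
    using i by (simp add: sum.remove)
  moreover have "(\<Sum>l<k. ?s d l - m l) = (?s d i - m i) + (\<Sum>l\<in>{..<k} - {i}. ?s d l - m l)"
    using i by (simp add: sum.remove)
  moreover have "(\<Sum>l\<in>{..<k} - {i}. ?s d l - m l) = (\<Sum>l\<in>{..<k} - {i}. ?s c l - m l)"
  proof (rule sum.cong[OF refl])
    fix l assume "l \<in> {..<k} - {i}"
    then show "?s d l - m l = ?s c l - m l" using dl[of l] dj j by (cases "l = j") auto
  qed
  ultimately have N: "N = (\<Sum>l<k. ?s d l - m l)" using di i(2) Suc.hyps(2) by simp
  have "\<And>u. u \<in> V \<Longrightarrow> d u < k" using Suc.prems j by (simp add: d_def)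
  from Suc.hyps(1)[OF N this] obtain c' where c': "\<forall>v\<in>V. c' v < k" "\<forall>i<k. ?s c' i = m i"
    "card {u\<in>V. c' u \<noteq> d u} \<le> N" using N by auto
  have "{u\<in>V. c' u \<noteq> c u} \<subseteq> insert v {u\<in>V. c' u \<noteq> d u}" by (auto simp: d_def)
  then have "card {u\<in>V. c' u \<noteq> c u} \<le> card (insert v {u\<in>V. c' u \<noteq> d u})"
    using assms(1) by (intro card_mono) auto
  also have "\<dots> \<le> Suc N" using c'(3) assms(1) by (simp add: card_insert_if)
  finally show ?case using c' Suc.hyps(2) by (intro exI[of _ c']) simp
qed

lemma rebalance:
  fixes c :: "'a \<Rightarrow> nat"
  assumes V: "finite V" and c: "\<And>v. v \<in> V \<Longrightarrow> c v < k" and k: "k \<ge> 1"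
    and sz: "\<And>i. i < k \<Longrightarrow> \<bar>real (card {v\<in>V. c v = i}) - real (card V) / real k\<bar> \<le> \<eta>"
  obtains c' where "\<And>v. v \<in> V \<Longrightarrow> c' v < k"
    "\<And>i j. i < k \<Longrightarrow> j < k \<Longrightarrow> card {v\<in>V. c' v = i} \<le> card {v\<in>V. c' v = j} + 1"
    "real (card {v\<in>V. c' v \<noteq> c v}) \<le> real k * (\<eta> + 1)"
proof -
  define n where "n = card V"
  \<comment> \<open>The balanced sizes: the first n mod k classes take one extra vertex. Rounding
    n/k down costs the summand 1 per class in the final bound.\<close>
  define m where "m = (\<lambda>i. n div k + (if i < n mod k then 1 else 0))"
  have "{..<k} \<inter> {i. i < n mod k} = {..<n mod k}"
    using k by (auto intro: less_trans[OF _ mod_less_divisor])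
  then have "(\<Sum>i<k. m i) = k * (n div k) + n mod k"
    unfolding m_def by (simp add: sum.distrib sum.If_cases)
  then have "(\<Sum>i<k. m i) = card V" by (simp add: n_def)
  then obtain c' where c': "\<forall>v\<in>V. c' v < k" "\<forall>i<k. card {v\<in>V. c' v = i} = m i"
    "card {v\<in>V. c' v \<noteq> c v} \<le> (\<Sum>i<k. card {v\<in>V. c v = i} - m i)"
    using recolour[where c = c and m = m, OF V c] by blast
  have "real (card {v\<in>V. c v = i} - m i) \<le> \<eta> + 1" if i: "i < k" for i
  proof -
    have "real n / real k \<le> real (n div k) + 1"
    proof -
      have "n \<le> k * (n div k) + k" using dividend_less_times_div[of k n] k by simp
      then have "real n \<le> real (k * (n div k) + k)" by (rule of_nat_mono)
      then show ?thesis using k by (simp add: field_simps)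
    qed
    moreover have "m i \<ge> n div k" by (simp add: m_def)
    moreover have "\<eta> \<ge> 0" using sz[OF i] by linarith
    ultimately show ?thesis using sz[OF i] unfolding n_def[symmetric]
      by (cases "card {v\<in>V. c v = i} \<ge> m i") (auto simp: of_nat_diff)
  qed
  then have "(\<Sum>i<k. real (card {v\<in>V. c v = i} - m i)) \<le> (\<Sum>i<k. \<eta> + 1)" by (intro sum_mono) auto
  then have "real (\<Sum>i<k. card {v\<in>V. c v = i} - m i) \<le> real k * (\<eta> + 1)" by simp
  then have "real (card {v\<in>V. c' v \<noteq> c v}) \<le> real k * (\<eta> + 1)" using c'(3) by linarith
  moreover have "card {v\<in>V. c' v = i} \<le> card {v\<in>V. c' v = j} + 1" if "i < k" "j < k" for i j
    using c'(2) that by (simp add: m_def)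
  ultimately show ?thesis using that[of c'] c'(1) by blast
qed

text \<open>A set that loses the rainbow property contains a recoloured vertex.\<close>

lemma card_rainbow_diff_le:
  assumes "finite V" "r \<ge> 1"
  shows "card (rainbow V c r - rainbow V c' r) \<le> card {v\<in>V. c' v \<noteq> c v} * card V ^ (r - 1)"
proof -
  let ?M = "(\<lambda>v. {v}) ` {v\<in>V. c' v \<noteq> c v}"
  have "rainbow V c r - rainbow V c' r \<subseteq> {X. X \<subseteq> V \<and> card X = r \<and> (\<exists>m\<in>?M. m \<subseteq> X)}"
  proof
    fix e assume e: "e \<in> rainbow V c r - rainbow V c' r"
    then have e': "e \<subseteq> V" "card e = r" "inj_on c e" "\<not> inj_on c' e" by (auto simp: rainbow_def)
    have "\<exists>v\<in>e. c' v \<noteq> c v" using e'(3,4) by (metis inj_on_cong)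
    then show "e \<in> {X. X \<subseteq> V \<and> card X = r \<and> (\<exists>m\<in>?M. m \<subseteq> X)}" using e'(1,2) by auto
  qed
  then have "card (rainbow V c r - rainbow V c' r) \<le> card {X. X \<subseteq> V \<and> card X = r \<and> (\<exists>m\<in>?M. m \<subseteq> X)}"
    by (rule card_mono[rotated]) (use assms(1) in simp)
  also have "\<dots> \<le> card ?M * card V ^ (r - 1)"
    by (rule card_supersets_le) (use assms(1) in auto)
  also have "card ?M = card {v\<in>V. c' v \<noteq> c v}" by (rule card_image) auto
  finally show ?thesis .
qed

section \<open>From a balanced colouring to the edit distance\<close>

lemma is_turan_rainbow:
  assumes "finite V" "\<And>v. v \<in> V \<Longrightarrow> c v < k"
    and "\<And>i j. i < k \<Longrightarrow> j < k \<Longrightarrow> card {v\<in>V. c v = i} \<le> card {v\<in>V. c v = j} + 1"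
  shows "is_turan r (card V) k \<lparr>verts = V, edges = rainbow V c r\<rparr>"
proof -
  let ?P = "\<lambda>i. {v\<in>V. c v = i}"
  have "inj_on c e \<longleftrightarrow> (\<forall>i<k. card (e \<inter> ?P i) \<le> 1)" if e: "e \<subseteq> V" for e
  proof
    assume i: "inj_on c e"
    show "\<forall>i<k. card (e \<inter> ?P i) \<le> 1"
    proof (intro allI impI)
      fix i
      have "card (e \<inter> ?P i) = card (c ` (e \<inter> ?P i))"
        using i by (intro card_image[symmetric]) (rule inj_on_subset, auto)
      also have "\<dots> \<le> card {i}" by (rule card_mono) auto
      finally show "card (e \<inter> ?P i) \<le> 1" by simp
    qed
  next
    assume a: "\<forall>i<k. card (e \<inter> ?P i) \<le> 1"
    show "inj_on c e"
    proof (rule inj_onI, rule ccontr)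
      fix x y assume xy: "x \<in> e" "y \<in> e" "c x = c y" "x \<noteq> y"
      have "card {x, y} \<le> card (e \<inter> ?P (c x))"
        using xy e assms(1) by (intro card_mono) (auto intro: finite_subset)
      moreover have "card (e \<inter> ?P (c x)) \<le> 1" using a xy e assms(2) by blast
      ultimately show False using xy(4) by simp
    qed
  qed
  then have "rainbow V c r = {e. e \<subseteq> V \<and> card e = r \<and> (\<forall>i<k. card (e \<inter> ?P i) \<le> 1)}"
    by (auto simp: rainbow_def)
  then show ?thesis
    unfolding is_turan_def using assms
    by (intro conjI exI[of _ ?P]) (auto simp: disjoint_family_on_def)
qed


text \<open>Deletion and closeness cost \<eta> n^r each. Rebalancing moves at most 2k\<eta>n
  vertices and changes at most 2k\<eta> n^r rainbow sets in each direction, which adds the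
  4k.\<close>

lemma transformable_from_colouring:
  fixes H :: "'a hypergraph"
  assumes H: "r_graph r H" and r: "1 \<le> r" and k: "1 \<le> k" and H': "H' \<subseteq> edges H"
    and del: "real (card (edges H - H')) \<le> \<eta> * real (card (verts H)) ^ r"
    and c: "\<And>v. c v < k"
    and close: "real (card (H' - rainbow (verts H) c r) + card (rainbow (verts H) c r - H'))
                  \<le> \<eta> * real (card (verts H)) ^ r"
    and sz: "\<And>i. i < k \<Longrightarrow> \<bar>real (card {v\<in>verts H. c v = i}) - real (card (verts H)) / real k\<bar>
                  \<le> \<eta> * real (card (verts H))"
    and large: "1 \<le> \<eta> * real (card (verts H))"
  shows "transformable_to_turan r (card (verts H)) k H ((2 + 4 * real k) * \<eta> * real (card (verts H)) ^ r)"
proof -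
  define V n where "V = verts H" and "n = real (card (verts H))"
  have fV: "finite V" and eV: "\<And>e. e \<in> edges H \<Longrightarrow> e \<subseteq> V"
    using H by (auto simp: r_graph_def V_def)
  have "edges H \<subseteq> Pow V" using eV by blast
  then have fH: "finite (edges H)" using fV by (simp add: finite_subset)
  obtain c' where c': "\<And>v. v \<in> V \<Longrightarrow> c' v < k"
    "\<And>i j. i < k \<Longrightarrow> j < k \<Longrightarrow> card {v\<in>V. c' v = i} \<le> card {v\<in>V. c' v = j} + 1"
    "real (card {v\<in>V. c' v \<noteq> c v}) \<le> real k * (\<eta> * n + 1)"
    by (rule rebalance[where V = V and c = c and k = k and \<eta> = "\<eta> * n"])
      (use fV c k sz that in \<open>auto simp: V_def n_def\<close>)
  let ?R = "rainbow V c r" and ?R' = "rainbow V c' r"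
  have fR: "finite ?R" "finite ?R'" using fV by (auto intro: finite_rainbow)
  define w where "w = card {v\<in>V. c' v \<noteq> c v} * card V ^ (r - 1)"
  have w1: "card (?R - ?R') \<le> w" unfolding w_def by (rule card_rainbow_diff_le[OF fV r])
  have w2: "card (?R' - ?R) \<le> w"
    using card_rainbow_diff_le[OF fV r, of c' c] unfolding w_def by (simp add: eq_commute)
  have "card (?R' - edges H) \<le> card ((?R' - ?R) \<union> (?R - H'))"
    using H' fR by (intro card_mono) auto
  also have "\<dots> \<le> w + card (?R - H')" using card_Un_le w2 by (meson add_right_mono le_trans)
  finally have t1: "card (?R' - edges H) \<le> w + card (?R - H')" .
  have "card (edges H - ?R') \<le> card ((edges H - H') \<union> (H' - ?R) \<union> (?R - ?R'))"
    using H' fR fH finite_subset[OF H' fH] by (intro card_mono) auto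
  also have "\<dots> \<le> card (edges H - H') + card (H' - ?R) + card (?R - ?R')"
    using card_Un_le by (meson add_right_mono le_trans)
  finally have t2: "card (edges H - ?R') \<le> card (edges H - H') + card (H' - ?R) + w" using w1 by simp
  have "real w \<le> real k * (\<eta> * n + 1) * n ^ (r - 1)"
    using c'(3) by (auto simp: w_def V_def n_def intro!: mult_right_mono)
  \<comment> \<open>As 1 \<le> \<eta>n, the rounding term is absorbed.\<close>
  also have "\<dots> \<le> real k * (\<eta> * n + \<eta> * n) * n ^ (r - 1)"
    using large by (intro mult_right_mono mult_left_mono) (auto simp: n_def)
  also have "\<dots> = 2 * real k * \<eta> * n ^ Suc (r - 1)" by (simp add: algebra_simps)
  finally have w: "real w \<le> 2 * real k * \<eta> * n ^ r" using r by simp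
  have "real (card (?R' - edges H) + card (edges H - ?R'))
      \<le> real (card (edges H - H')) + real (card (H' - ?R) + card (?R - H')) + 2 * real w"
    using t1 t2 by simp
  also have "\<dots> \<le> \<eta> * n ^ r + \<eta> * n ^ r + 2 * (2 * real k * \<eta> * n ^ r)"
    using del close w by (simp add: V_def n_def)
  also have "\<dots> = (2 + 4 * real k) * \<eta> * n ^ r" by (simp add: algebra_simps)
  finally show ?thesis
    unfolding transformable_to_turan_def using is_turan_rainbow[OF fV c'(1,2), where r = r]
    by (intro exI[of _ "\<lparr>verts = V, edges = ?R'\<rparr>"]) (simp add: V_def n_def)
qed

theorem theorem3p2:
  fixes p :: real and k r :: nat
  assumes "p > 1" and "r \<ge> 3" and "k \<ge> r"
  shows "\<forall>\<epsilon>::real. \<epsilon> > 0 \<longrightarrow>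
    (\<exists>\<delta>::real. \<delta> > 0 \<and> (\<exists>n\<^sub>0::nat. \<forall>n>n\<^sub>0. \<forall>H::nat hypergraph.
       r_graph r H \<longrightarrow> card (verts H) = n \<longrightarrow> is_free (F_graph r (k + 1)) H \<longrightarrow>
       p_spectral_radius r p H >
         (1 - \<delta>) * (falling_factorial k r / real k ^ r) * real n powr (real r * (1 - 1 / p)) \<longrightarrow>
       transformable_to_turan r n k H (\<epsilon> * real (n choose r))))"
proof (intro allI impI)
  fix \<epsilon> :: real assume \<epsilon>: "\<epsilon> > 0"
  have r: "1 \<le> r" "2 \<le> r" "1 \<le> k" using assms by auto
  \<comment> \<open>The factor 2 + 4k is the loss in \<open>transformable_from_colouring\<close>;
    r^r converts n^r into a binomial coefficient through (n/r)^r \<le>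
    \<open>n choose r\<close>.\<close>
  define \<eta> where "\<eta> = \<epsilon> / (real r ^ r * (2 + 4 * real k))"
  have \<eta>: "\<eta> > 0" using \<epsilon> r by (simp add: \<eta>_def)
  obtain \<delta>1 where \<delta>1: "\<delta>1 > 0" and stab: "\<And>(V::nat set) E H. clique_limited k r V E H \<Longrightarrow>
      (turan_density k r - \<delta>1) * real (card V) ^ r \<le> real (card H) \<Longrightarrow>
      \<exists>c. (\<forall>v. c v < k) \<and>
        real (card (H - rainbow V c r) + card (rainbow V c r - H)) \<le> \<eta> * real (card V) ^ r \<and>
        (\<forall>i<k. \<bar>real (card {v\<in>V. c v = i}) - real (card V) / real k\<bar> \<le> \<eta> * real (card V))"
    by (rule clique_limited_stability[OF r(2) assms(3) \<eta>]) (rule that)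
  obtain \<delta> \<kappa> where \<delta>: "\<delta> > 0" and \<kappa>: "\<kappa> > 0" and many:
    "\<And>(H :: nat hypergraph) E H'. r_graph r H \<Longrightarrow> verts H \<noteq> {} \<Longrightarrow>
      clique_limited k r (verts H) E H' \<Longrightarrow> H' \<subseteq> edges H \<Longrightarrow>
      real (card (edges H - H')) \<le> \<kappa> * real (card (verts H)) ^ r \<Longrightarrow>
      p_spectral_radius r p H > (1 - \<delta>) * (falling_factorial k r / real k ^ r)
        * real (card (verts H)) powr (real r * (1 - 1 / p)) \<Longrightarrow>
      (turan_density k r - \<delta>1) * real (card (verts H)) ^ r \<le> real (card H')"
    by (rule spectral_imp_many_edges[OF assms(1) r(1) assms(3) \<delta>1]) (rule that)
  define C where "C = (k + 1) + (k + 1)\<^sup>2 * r"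
  define \<mu> where "\<mu> = min \<eta> \<kappa>"
  have \<mu>: "\<mu> > 0" "\<mu> \<le> \<eta>" "\<mu> \<le> \<kappa>" using \<eta> \<kappa> by (auto simp: \<mu>_def)
  \<comment> \<open>Beyond \<open>n0\<close> the C n^(r-1) deleted edges number at most \<mu>
    n^r.\<close>
  obtain n0 :: nat where n0: "real C / \<mu> < real n0" using reals_Archimedean2 by blast
  show "\<exists>\<delta>::real. \<delta> > 0 \<and> (\<exists>n\<^sub>0::nat. \<forall>n>n\<^sub>0. \<forall>H::nat hypergraph.
       r_graph r H \<longrightarrow> card (verts H) = n \<longrightarrow> is_free (F_graph r (k + 1)) H \<longrightarrow>
       p_spectral_radius r p H >
         (1 - \<delta>) * (falling_factorial k r / real k ^ r) * real n powr (real r * (1 - 1 / p)) \<longrightarrow>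
       transformable_to_turan r n k H (\<epsilon> * real (n choose r)))"
  \<comment> \<open>The maximum with r ensures r \<le> n, as the lower bound on the binomial
    coefficient requires.\<close>
  proof (intro exI[of _ \<delta>] conjI \<delta> exI[of _ "max n0 r"] allI impI)
    fix n and H :: "nat hypergraph"
    assume n: "max n0 r < n" and H: "r_graph r H" and cn: "card (verts H) = n"
      and free: "is_free (F_graph r (k + 1)) H"
      and big: "p_spectral_radius r p H >
         (1 - \<delta>) * (falling_factorial k r / real k ^ r) * real n powr (real r * (1 - 1 / p))"
    have ne: "verts H \<noteq> {}" using n cn by auto
    have "real C / \<mu> < real n" using n0 n by simp
    then have C: "real C \<le> \<mu> * real n" using \<mu>(1) by (simp add: pos_divide_less_eq mult.commute)
    obtain E H' where lim: "clique_limited k r (verts H) E H'" and H': "H' \<subseteq> edges H"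
      and del: "card (edges H - H') \<le> C * card (verts H) ^ (r - 1)"
      by (rule F_free_reduction[OF H free assms(2,3), folded C_def]) (rule that)
    have "real (card (edges H - H')) \<le> real C * real n ^ (r - 1)"
      using del unfolding cn by (metis of_nat_le_iff of_nat_mult of_nat_power)
    also have "\<dots> \<le> \<mu> * real n * real n ^ (r - 1)" using C by (intro mult_right_mono) auto
    also have "\<dots> = \<mu> * real n ^ Suc (r - 1)" by simp
    finally have del': "real (card (edges H - H')) \<le> \<mu> * real n ^ r" using r by simp
    have del2: "real (card (edges H - H')) \<le> t * real n ^ r" if "\<mu> \<le> t" for t
      using del' mult_right_mono[OF that, of "real n ^ r"] by simp
    have "(turan_density k r - \<delta>1) * real (card (verts H)) ^ r \<le> real (card H')"
      by (rule many[OF H ne lim H']) (use del2[OF \<mu>(3)] big cn in auto)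
    from stab[OF lim this] obtain c where c: "\<And>v. c v < k"
      and close: "real (card (H' - rainbow (verts H) c r) + card (rainbow (verts H) c r - H'))
                    \<le> \<eta> * real (card (verts H)) ^ r"
      and sz: "\<And>i. i < k \<Longrightarrow> \<bar>real (card {v\<in>verts H. c v = i}) - real (card (verts H)) / real k\<bar>
                    \<le> \<eta> * real (card (verts H))" by blast
    have "1 \<le> real C" by (simp add: C_def)
    also have "\<dots> \<le> \<eta> * real n" using C mult_right_mono[OF \<mu>(2), of "real n"] by simp
    finally have large: "1 \<le> \<eta> * real (card (verts H))" by (simp add: cn)
    have "transformable_to_turan r n k H ((2 + 4 * real k) * \<eta> * real n ^ r)"
      using transformable_from_colouring[OF H r(1,3) H' _ c close sz large] del2[OF \<mu>(2)]
      by (simp add: cn)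
    moreover have "(2 + 4 * real k) * \<eta> * real n ^ r \<le> \<epsilon> * real (n choose r)"
    proof -
      have "(2 + 4 * real k) * \<eta> = \<epsilon> / real r ^ r"
      proof -
        have "2 + 4 * real k \<noteq> 0" by linarith
        then show ?thesis by (simp add: \<eta>_def)
      qed
      then have "(2 + 4 * real k) * \<eta> * real n ^ r = \<epsilon> * (real n / real r) ^ r"
        by (simp add: power_divide)
      also have "\<dots> \<le> \<epsilon> * real (n choose r)"
        using binomial_ge_n_over_k_pow_k[of r n, where 'a = real] n \<epsilon> by (intro mult_left_mono) auto
      finally show ?thesis .
    qed
    ultimately show "transformable_to_turan r n k H (\<epsilon> * real (n choose r))"
      unfolding transformable_to_turan_def using order_trans by blast
  qed
qed

end
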